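(* Let $J$ be a two-sided Jacobi matrix with coefficients $a_n>0$, $b_n\in\mathbb R$ ($n\in\mathbb Z$), limit-point at both $\pm\infty$. Assume that at the point $\xi\in\mathbb R$ the normal limit $\eta=\lim_{y\downarrow 0} m_+(\xi+iy)$ exists and is in $\mathbb C_+$. Let $k_l<n_l$ be any sequences of integers with $\inf_l k_l>-\infty$, $n_l\to\infty$ as $l\to\infty$, and $$\limsup_{l\to\infty}\frac{c_{[0,k_l]}}{c_{[0,n_l]}}<1 .$$ Then $$\lim_{l\to\infty} c_{[k_l,n_l]}\left(\xi_{j+1}^{[k_l,n_l]}-\xi_j^{[k_l,n_l]}\right)=1\qquad\text{for all } j\in\mathbb Z .$$
   Context: $\mathbb C_+=\{z\in\mathbb C:\Im z>0\}$. $J$ acts formally by $(Ju)_n=a_{n-1}u_{n-1}+b_nu_n+a_nu_{n+1}$ on $\ell^2(\mathbb Z)$. Limit-point at both $\pm\infty$ means, equivalently, that $J$ is self-adjoint with the compactly supported sequences as a core. $J_+$ is the restriction of $J$ to $\ell^2(\{n\ge 1\})$, and $m_+(z)=\langle\delta_1,(J_+-z)^{-1}\delta_1\rangle$ is its Weyl $m$-function. For integers $k<n$, $J_{[k,n]}$ is the $(n-k)\times(n-k)$ tridiagonal symmetric matrix with diagonal entries $b_{k+1},\dots,b_n$ and off-diagonal entries $a_{k+1},\dots,a_{n-1}$. Its eigenvalues (all simple) are labelled around $\xi$ by $$\dots<\xi_{-1}^{[k,n]}<\xi_0^{[k,n]}<\xi\le\xi_1^{[k,n]}<\xi_2^{[k,n]}<\dots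 .$$ A limit statement involving $\xi_j^{[k_l,n_l]}$ for fixed $j$ includes the assertion that these eigenvalues exist for all sufficiently large $l$. Scaling sequence: let $\psi=(\psi_n)_{n\in\mathbb Z}$ be a nontrivial solution of $a_{n-1}\psi_{n-1}+b_n\psi_n+a_n\psi_{n+1}=\xi\psi_n$ with $-\psi_1/(a_0\psi_0)=\eta$ (unique up to a multiplicative constant). The Wronskian $W(\overline\psi,\psi)=a_n(\overline{\psi_{n+1}}\psi_n-\overline{\psi_n}\psi_{n+1})$ is independent of $n$ and $W(\overline\psi,\psi)/i>0$. For integers $k\le n$, $$c_{[k,n]}=\frac{i}{\pi W(\overline\psi,\psi)}\sum_{j=k+1}^n|\psi_j|^2,\qquad c_{[n,k]}=-c_{[k,n]} .$$ This is independent of the normalization of $\psi$. *)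

theory Defs
  imports "HOL-Analysis.Analysis" "Jordan_Normal_Form.Char_Poly"
begin

section \<open>Operators in sequence spaces\<close>

text \<open>For \<open>S \<subseteq> \<int>\<close>, the Hilbert space \<open>\<ell>\<^sup>2(S)\<close> is represented by the square-summable
  two-sided sequences vanishing outside \<open>S\<close>.\<close>

definition ell2 :: "int set \<Rightarrow> (int \<Rightarrow> complex) set" where
  "ell2 S = {u. (\<forall>n. n \<notin> S \<longrightarrow> u n = 0) \<and> (\<lambda>n. (cmod (u n))\<^sup>2) summable_on UNIV}"

definition ell2_inner :: "(int \<Rightarrow> complex) \<Rightarrow> (int \<Rightarrow> complex) \<Rightarrow> complex" where
  "ell2_inner u v = (\<Sum>\<^sub>\<infinity>n. cnj (u n) * v n)"

definition ell2_norm :: "(int \<Rightarrow> complex) \<Rightarrow> real" where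
  "ell2_norm u = sqrt (\<Sum>\<^sub>\<infinity>n. (cmod (u n))\<^sup>2)"

definition delta :: "int \<Rightarrow> int \<Rightarrow> complex" where
  "delta m n = (if n = m then 1 else 0)"

text \<open>An unbounded operator in \<open>\<ell>\<^sup>2(S)\<close> is given by a domain \<open>D\<close> and an action \<open>T\<close>,
  of which only the values on \<open>D\<close> matter.\<close>

definition op_graph ::
  "(int \<Rightarrow> complex) set \<Rightarrow> ((int \<Rightarrow> complex) \<Rightarrow> int \<Rightarrow> complex)
    \<Rightarrow> ((int \<Rightarrow> complex) \<times> (int \<Rightarrow> complex)) set" where
  "op_graph D T = {(u, T u) | u. u \<in> D}"

definition adjoint_graph ::
  "int set \<Rightarrow> (int \<Rightarrow> complex) set \<Rightarrow> ((int \<Rightarrow> complex) \<Rightarrow> int \<Rightarrow> complex)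
    \<Rightarrow> ((int \<Rightarrow> complex) \<times> (int \<Rightarrow> complex)) set" where
  "adjoint_graph S D T =
    {(v, w). v \<in> ell2 S \<and> w \<in> ell2 S \<and> (\<forall>u\<in>D. ell2_inner v (T u) = ell2_inner w u)}"

definition densely_defined :: "int set \<Rightarrow> (int \<Rightarrow> complex) set \<Rightarrow> bool" where
  "densely_defined S D \<longleftrightarrow>
    D \<subseteq> ell2 S \<and> (\<forall>u\<in>ell2 S. \<forall>e>0. \<exists>v\<in>D. ell2_norm (\<lambda>n. u n - v n) < e)"

definition self_adjoint ::
  "int set \<Rightarrow> (int \<Rightarrow> complex) set \<Rightarrow> ((int \<Rightarrow> complex) \<Rightarrow> int \<Rightarrow> complex) \<Rightarrow> bool" where
  "self_adjoint S D T \<longleftrightarrow> densely_defined S D \<and> adjoint_graph S D T = op_graph D T"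

text \<open>A core is a subset of the domain that is dense in it for the graph norm.\<close>

definition is_core ::
  "(int \<Rightarrow> complex) set \<Rightarrow> ((int \<Rightarrow> complex) \<Rightarrow> int \<Rightarrow> complex) \<Rightarrow> (int \<Rightarrow> complex) set \<Rightarrow> bool" where
  "is_core D T C \<longleftrightarrow> C \<subseteq> D \<and>
    (\<forall>u\<in>D. \<forall>e>0. \<exists>v\<in>C. ell2_norm (\<lambda>n. u n - v n) < e \<and> ell2_norm (\<lambda>n. T u n - T v n) < e)"


section \<open>Jacobi matrices\<close>

definition jacobi :: "(int \<Rightarrow> real) \<Rightarrow> (int \<Rightarrow> real) \<Rightarrow> (int \<Rightarrow> complex) \<Rightarrow> int \<Rightarrow> complex" where
  "jacobi a b u n =
    of_real (a (n - 1)) * u (n - 1) + of_real (b n) * u n + of_real (a n) * u (n + 1)"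

text \<open>The restriction of the Jacobi matrix to \<open>\<ell>\<^sup>2(S)\<close>. On sequences vanishing outside \<open>S\<close>,
  all matrix entries linking \<open>S\<close> to its complement drop out; the domain is the maximal one.\<close>

definition jacobi_on ::
  "int set \<Rightarrow> (int \<Rightarrow> real) \<Rightarrow> (int \<Rightarrow> real) \<Rightarrow> (int \<Rightarrow> complex) \<Rightarrow> int \<Rightarrow> complex" where
  "jacobi_on S a b u = (\<lambda>n. if n \<in> S then jacobi a b u n else 0)"

definition jacobi_dom :: "int set \<Rightarrow> (int \<Rightarrow> real) \<Rightarrow> (int \<Rightarrow> real) \<Rightarrow> (int \<Rightarrow> complex) set" where
  "jacobi_dom S a b = {u \<in> ell2 S. jacobi_on S a b u \<in> ell2 S}"

text \<open>The maximal domain is no extra choice here: if some realization of the formal Jacobi matrix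
  is self-adjoint with the compactly supported sequences as a core, then it is the adjoint of its
  restriction to these sequences, and that adjoint is the maximal operator.\<close>

definition limit_point_both :: "(int \<Rightarrow> real) \<Rightarrow> (int \<Rightarrow> real) \<Rightarrow> bool" where
  "limit_point_both a b \<longleftrightarrow>
    self_adjoint UNIV (jacobi_dom UNIV a b) (jacobi_on UNIV a b) \<and>
    is_core (jacobi_dom UNIV a b) (jacobi_on UNIV a b) {u. finite {n. u n \<noteq> 0}}"

definition m_plus :: "(int \<Rightarrow> real) \<Rightarrow> (int \<Rightarrow> real) \<Rightarrow> complex \<Rightarrow> complex" where
  "m_plus a b z = ell2_inner (delta 1)
    (the_inv_into (jacobi_dom {1..} a b) (\<lambda>u n. jacobi_on {1..} a b u n - z * u n) (delta 1))"


section \<open>Eigenvalues of finite truncations\<close>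

text \<open>Row and column \<open>i\<close> (counted from \<open>0\<close>) belong to the site \<open>k + 1 + i\<close>.\<close>

definition jacobi_trunc :: "(int \<Rightarrow> real) \<Rightarrow> (int \<Rightarrow> real) \<Rightarrow> int \<Rightarrow> int \<Rightarrow> real mat" where
  "jacobi_trunc a b k n = mat (nat (n - k)) (nat (n - k))
    (\<lambda>(i, j). if i = j then b (k + 1 + int i)
             else if j = Suc i then a (k + 1 + int i)
             else if i = Suc j then a (k + 1 + int j)
             else 0)"

text \<open>\<open>is_labelled_eig a b \<xi> k n j x\<close> means that \<open>x\<close> is the eigenvalue carrying the label \<open>j\<close> when
  the (simple) eigenvalues are numbered increasingly with label \<open>1\<close> for the smallest one in
  \<open>[\<xi>, \<infinity>)\<close> and label \<open>0\<close> for the largest one in \<open>(-\<infinity>, \<xi>)\<close>.\<close>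

definition is_labelled_eig ::
  "(int \<Rightarrow> real) \<Rightarrow> (int \<Rightarrow> real) \<Rightarrow> real \<Rightarrow> int \<Rightarrow> int \<Rightarrow> int \<Rightarrow> real \<Rightarrow> bool" where
  "is_labelled_eig a b \<xi> k n j x \<longleftrightarrow>
    eigenvalue (jacobi_trunc a b k n) x \<and>
    (if j \<ge> 1
     then \<xi> \<le> x \<and> int (card {y. eigenvalue (jacobi_trunc a b k n) y \<and> \<xi> \<le> y \<and> y < x}) = j - 1
     else x < \<xi> \<and> int (card {y. eigenvalue (jacobi_trunc a b k n) y \<and> x < y \<and> y < \<xi>}) = - j)"

definition labelled_eig ::
  "(int \<Rightarrow> real) \<Rightarrow> (int \<Rightarrow> real) \<Rightarrow> real \<Rightarrow> int \<Rightarrow> int \<Rightarrow> int \<Rightarrow> real" where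
  "labelled_eig a b \<xi> k n j = (THE x. is_labelled_eig a b \<xi> k n j x)"


section \<open>The scaling sequence\<close>

definition wronskian ::
  "(int \<Rightarrow> real) \<Rightarrow> (int \<Rightarrow> complex) \<Rightarrow> (int \<Rightarrow> complex) \<Rightarrow> int \<Rightarrow> complex" where
  "wronskian a u v n = of_real (a n) * (u (n + 1) * v n - u n * v (n + 1))"

text \<open>The Wronskian of \<open>cnj \<circ> \<psi>\<close> and \<open>\<psi>\<close> is constant for a solution \<open>\<psi>\<close> at a real spectral
  parameter, so it is evaluated at \<open>0\<close>; it is purely imaginary, so taking the real part only
  converts the type.\<close>

definition scale_c :: "(int \<Rightarrow> real) \<Rightarrow> (int \<Rightarrow> complex) \<Rightarrow> int \<Rightarrow> int \<Rightarrow> real" where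
  "scale_c a \<psi> k n =
    (let c = (\<lambda>p q. Re (\<i> / (of_real pi * wronskian a (\<lambda>m. cnj (\<psi> m)) \<psi> 0)
                        * of_real (\<Sum>j=p+1..q. (cmod (\<psi> j))\<^sup>2)))
     in if k \<le> n then c k n else - c n k)"

end

theory Submission
  imports Defs "HOL-Complex_Analysis.Great_Picard" "Jordan_Normal_Form.Spectral_Radius"
begin

text \<open>
  Write a solution at energy \<open>\<xi> + z\<close> as \<open>u n = \<alpha> n * \<psi> n + \<beta> n * cnj (\<psi> n)\<close> (variation of constants). The
  coefficients \<open>(\<alpha>, \<beta>)\<close> are propagated from site \<open>0\<close> to site \<open>n\<close> by a matrix of determinant \<open>1\<close> whose
  first column consists of polynomials \<open>cA n z\<close>, \<open>cB n z\<close> and whose second column is obtained from the first by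
  conjugation. The core of the proof is the scaling limit (\<open>transfer_limit\<close>): with \<open>cc n\<close> the scaling sequence based
  at \<open>0\<close>, locally uniformly in \<open>z\<close>,
  \<open>cA n (z / cc n)\<close> tends to \<open>exp (\<i> * \<pi> * z)\<close> and \<open>cB n (z / cc n)\<close> tends to \<open>0\<close>.

  The rescaled functions are bounded by \<open>exp (2 * \<pi> * \<bar>z\<bar>)\<close>, so they form a normal family; let \<open>(f, g)\<close> be a
  subsequential limit. Green's identity says that \<open>\<bar>\<alpha>\<bar>\<^sup>2 - \<bar>\<beta>\<bar>\<^sup>2\<close> increases with the site in the lower
  half-plane, which gives \<open>\<bar>g\<bar> \<le> \<bar>f\<bar>\<close> there. In the upper half-plane the Weyl solution starts from \<open>(1, s z)\<close>
  with a holomorphic \<open>s\<close> bounded by \<open>1\<close> and satisfies \<open>\<bar>\<beta>\<bar> \<le> \<bar>\<alpha>\<bar>\<close> at every site (\<open>weyl_function\<close>). The hypothesis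
  on the \<open>m\<close>-function says that \<open>s\<close> tends to \<open>0\<close> at the origin along the imaginary axis
  (\<open>weyl_function_normal_limit\<close>), and a normal family argument extends this to every ray. So \<open>s (z / cc n)\<close> tends to
  \<open>0\<close>, and \<open>\<bar>g\<bar> \<le> \<bar>f\<bar>\<close> holds above the real axis as well. Since \<open>f\<close> and \<open>g\<close> have no common zero, \<open>g / f\<close>
  is a bounded entire function, equal to \<open>0\<close> at the origin; hence \<open>g = 0\<close>. Now the determinant shows that \<open>f\<close> has
  no zero, and an entire function of exponential type without zeros is an exponential
  (\<open>entire_exponential_type_no_zeros\<close>).

  The transfer matrix from \<open>k\<close> to \<open>n\<close>, evaluated at \<open>y / \<tau>\<close> with \<open>\<tau> = cc n - cc k\<close>, is then close to the
  diagonal matrix with entries \<open>exp (\<plusminus> \<i> * \<pi> * y)\<close>. The bound on the ratio of the scales keeps \<open>cc n / \<tau>\<close> and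
  \<open>cc k / \<tau>\<close> bounded, and the lower bound on \<open>k\<close> leaves only finitely many left endpoints outside the asymptotic
  regime. The number \<open>\<xi> + y / \<tau>\<close> is an eigenvalue if and only if the imaginary part of a complex number close to
  \<open>exp (\<i> * \<pi> * (y - \<gamma>))\<close> vanishes (\<open>eigenvalue_iff_transfer\<close>, \<open>near_sine_of_transfer\<close>). The phase \<open>\<gamma>\<close> depends
  on \<open>k\<close> and \<open>n\<close> without any control, but consecutive zeros of \<open>sin (\<pi> * (y - \<gamma>))\<close> have distance \<open>1\<close> for every
  \<open>\<gamma>\<close>.
\<close>

section \<open>Entire functions and bounded functions on the half-plane\<close>

text \<open>Turns compactness into convergence: to get a statement for all large \<open>n\<close>,
  it is enough to meet it once along every subsequence, for instance along a convergent one inside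
  it.\<close>

lemma eventually_if_subsequences_meet:
  assumes "\<And>r :: nat \<Rightarrow> nat. strict_mono r \<Longrightarrow> \<exists>m. P (r m)"
  shows "eventually P sequentially"
proof (rule ccontr)
  assume "\<not> eventually P sequentially"
  then have inf: "infinite {n. \<not> P n}"
    by (simp add: cofinite_eq_sequentially[symmetric] eventually_cofinite)
  from assms[OF strict_mono_enumerate[OF inf]] enumerate_in_set[OF inf]
  show False by auto
qed

text \<open>The function has an entire logarithm \<open>h\<close> whose real part grows at most
  linearly. The Schwarz lemma, applied to \<open>h / (2Kr - h)\<close> on the disc of radius
  \<open>r\<close>, turns this one-sided bound into a linear bound for
  \<open>\<bar>h\<bar>\<close>, so \<open>h\<close> is a linear polynomial by Liouville.\<close>

lemma entire_exponential_type_no_zeros: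
  fixes f :: "complex \<Rightarrow> complex"
  assumes holf: "f holomorphic_on UNIV" and nz: "\<And>z. f z \<noteq> 0" and f0: "f 0 = 1"
    and growth: "\<And>z. cmod (f z) \<le> exp (C * cmod z)"
  shows "f z = exp (deriv f 0 * z)"
proof -
  obtain g where holg: "g holomorphic_on UNIV" and g: "\<And>x. exp (g x) = f x"
    using holomorphic_logarithm_exists[of UNIV f 0] holf nz by auto
  define h where "h = (\<lambda>z. g z - g 0)"
  have holh: "h holomorphic_on UNIV"
    unfolding h_def by (intro holomorphic_intros holg)
  have eh: "exp (h x) = f x" for x
    using g[of x] g[of 0] f0 by (simp add: h_def exp_diff)
  have h0: "h 0 = 0" by (simp add: h_def)
  define K where "K = \<bar>C\<bar> + 1"
  have K: "K > 0" "C \<le> K" by (auto simp: K_def)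
  have Reh: "Re (h x) \<le> K * cmod x" for x
  proof -
    have "exp (Re (h x)) = cmod (f x)" by (metis eh norm_exp_eq_Re)
    also have "\<dots> \<le> exp (C * cmod x)" by (rule growth)
    finally have "Re (h x) \<le> C * cmod x" by simp
    also have "\<dots> \<le> K * cmod x" using K by (intro mult_right_mono) auto
    finally show ?thesis .
  qed
  have bound: "cmod (h z) \<le> 4 * K * cmod z ^ 1" for z
  proof (cases "z = 0")
    case False
    (* With this radius z sits at half the radius, and the Schwarz lemma absorbs the term cmod (h
       z) on the right. *)
    define r where "r = 2 * cmod z"
    have r: "r > 0" using False by (simp add: r_def)
    define \<phi> where "\<phi> = (\<lambda>\<zeta>. h (of_real r * \<zeta>) / (of_real (2 * K * r) - h (of_real r * \<zeta>)))"
    have less: "Re (h (of_real r * \<zeta>)) < K * r" if "cmod \<zeta> < 1" for \<zeta>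
    proof -
      have "Re (h (of_real r * \<zeta>)) \<le> K * (r * cmod \<zeta>)"
        using Reh[of "of_real r * \<zeta>"] r by (simp add: norm_mult)
      also have "\<dots> < K * r" using that r K by simp
      finally show ?thesis .
    qed
    have Kr: "K * r > 0" using K r by simp
    have lt: "cmod (h (of_real r * \<zeta>)) < cmod (of_real (2 * K * r) - h (of_real r * \<zeta>))"
      if "cmod \<zeta> < 1" for \<zeta>
    proof -
      let ?w = "h (of_real r * \<zeta>)"
      have "0 < (K * r) * (K * r - Re ?w)" using less[OF that] Kr by simp
      then have "(cmod ?w)\<^sup>2 < (cmod (of_real (2 * K * r) - ?w))\<^sup>2"
        unfolding cmod_power2 by (simp add: power2_eq_square algebra_simps)
      then show ?thesis by (rule power2_less_imp_less) simp
    qed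
    have 1: "\<phi> holomorphic_on ball 0 1"
      unfolding \<phi>_def
    proof (intro holomorphic_intros)
      show "(\<lambda>\<zeta>. h (of_real r * \<zeta>)) holomorphic_on ball 0 1"
        by (rule holomorphic_on_compose_gen[of "\<lambda>\<zeta>. of_real r * \<zeta>" _ h UNIV, unfolded o_def])
          (auto intro!: holomorphic_intros holh)
      then show "(\<lambda>\<zeta>. h (of_real r * \<zeta>)) holomorphic_on ball 0 1" .
      fix \<zeta> :: complex assume "\<zeta> \<in> ball 0 1"
      then show "of_real (2 * K * r) - h (of_real r * \<zeta>) \<noteq> 0"
        using lt[of \<zeta>] norm_ge_zero[of "h (of_real r * \<zeta>)"] by (auto simp del: norm_ge_zero)
    qed
    have 3: "cmod (\<phi> \<zeta>) < 1" if "cmod \<zeta> < 1" for \<zeta>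
    proof -
      have "0 < cmod (of_real (2 * K * r) - h (of_real r * \<zeta>))"
        using lt[OF that] norm_ge_zero[of "h (of_real r * \<zeta>)"] by linarith
      then show ?thesis unfolding \<phi>_def norm_divide using lt[OF that] by (simp only: divide_less_eq_1_pos)
    qed
    have z2: "cmod (z / of_real r) = 1/2" using False r
      by (simp add: norm_divide r_def)
    have "cmod (\<phi> (z / of_real r)) \<le> cmod (z / of_real r)"
      by (rule Schwarz_Lemma(1)[OF 1 _ 3]) (auto simp: z2 \<phi>_def h0)
    then have le: "cmod (h z) / cmod (of_real (2 * K * r) - h z) \<le> 1/2"
      using z2 r by (simp add: \<phi>_def norm_divide)
    have "cmod (h z) < cmod (of_real (2 * K * r) - h z)"
      using lt[of "z / of_real r"] z2 r by simp
    then have "cmod (of_real (2 * K * r) - h z) > 0"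
      using norm_ge_zero[of "h z"] by linarith
    with le have "2 * cmod (h z) \<le> cmod (of_real (2 * K * r) - h z)"
      by (simp add: divide_le_eq)
    also have "\<dots> \<le> 2 * K * r + cmod (h z)"
      using norm_triangle_ineq4[of "of_real (2 * K * r)" "h z"] K r by (simp add: norm_mult)
    finally show ?thesis by (simp add: r_def)
  qed (simp add: h0)
  have lin: "h z = deriv h 0 * z" for z
    using Liouville_polynomial[OF holh, of 0 "4 * K" 1 z] bound h0 by simp
  have "(h has_field_derivative deriv h 0) (at 0)"
    using holh by (simp add: holomorphic_derivI)
  then have "((\<lambda>z. exp (h z)) has_field_derivative exp (h 0) * deriv h 0) (at 0)"
    by (rule DERIV_chain2[OF DERIV_exp])
  then have "deriv f 0 = deriv h 0" using h0 eh by (simp add: DERIV_imp_deriv)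
  with lin eh[of z] show ?thesis by simp
qed

text \<open>A radial limit along the imaginary axis controls all directions: the rescaled functions
  \<open>z \<mapsto> s (t z)\<close> form a normal family on the half-plane, and each of their
  limits vanishes on the imaginary axis, hence identically.\<close>

lemma holomorphic_upper_half_plane_scaling:
  fixes s :: "complex \<Rightarrow> complex"
  assumes hols: "s holomorphic_on {z. Im z > 0}"
    and bd: "\<And>z. Im z > 0 \<Longrightarrow> cmod (s z) \<le> B"
    and lim: "((\<lambda>y. s (Complex 0 y)) \<longlongrightarrow> 0) (at_right 0)"
    and tpos: "\<And>m. t m > 0" and t0: "t \<longlonglongrightarrow> 0" and z: "Im z > 0"
  shows "(\<lambda>m. s (of_real (t m) * z)) \<longlonglongrightarrow> 0"
  unfolding tendsto_iff
proof (intro allI impI)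
  fix e :: real assume e: "e > 0"
  let ?H = "{z. Im z > 0}"
  have oH: "open ?H" by (rule open_halfspace_Im_gt)
  have cH: "connected ?H" using convex_halfspace_Im_gt convex_connected by blast
  show "\<forall>\<^sub>F m in sequentially. dist (s (of_real (t m) * z)) 0 < e"
  proof (rule eventually_if_subsequences_meet)
    fix r :: "nat \<Rightarrow> nat" assume r: "strict_mono r"
    define F where "F = (\<lambda>m z. s (of_real (t (r m)) * z))"
    define \<H> where "\<H> = {h. h holomorphic_on ?H \<and> (\<forall>z\<in>?H. cmod (h z) \<le> B)}"
    have F: "F m \<in> \<H>" for m
      unfolding F_def \<H>_def
    proof (intro CollectI conjI ballI)
      show "(\<lambda>z. s (of_real (t (r m)) * z)) holomorphic_on ?H"
        by (rule holomorphic_on_compose_gen[of "\<lambda>\<zeta>. of_real (t (r m)) * \<zeta>" _ s ?H, unfolded o_def])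
          (use tpos in \<open>auto intro!: holomorphic_intros hols\<close>)
    qed (use tpos in \<open>auto intro!: bd\<close>)
    obtain g q where g: "g holomorphic_on ?H" and q: "strict_mono (q :: nat \<Rightarrow> nat)"
      and lg: "\<And>x. x \<in> ?H \<Longrightarrow> (\<lambda>m. F (q m) x) \<longlonglongrightarrow> g x"
    proof (rule Montel[OF oH, of \<H> F])
      show "\<exists>B. \<forall>h\<in>\<H>. \<forall>z\<in>K. cmod (h z) \<le> B" if "compact K" "K \<subseteq> ?H" for K
        by (rule exI[of _ B]) (use that in \<open>auto simp: \<H>_def\<close>)
    qed (use F in \<open>auto simp: \<H>_def\<close>)
    have g_axis: "g (Complex 0 y) = 0" if y: "y > 0" for y
    proof -
      have tne: "t m \<noteq> 0" for m using tpos[of m] by simp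
      have tt: "(\<lambda>m. t (r (q m))) \<longlonglongrightarrow> 0"
        using LIMSEQ_subseq_LIMSEQ[OF LIMSEQ_subseq_LIMSEQ[OF t0 r] q] by (simp add: o_def)
      have "filterlim (\<lambda>m. t (r (q m)) * y) (at_right 0) sequentially"
        unfolding filterlim_at
      proof
        show "\<forall>\<^sub>F m in sequentially. t (r (q m)) * y \<in> {0<..} \<and> t (r (q m)) * y \<noteq> 0"
          using y tpos tne by (intro always_eventually) simp
        show "(\<lambda>m. t (r (q m)) * y) \<longlonglongrightarrow> 0"
          using tendsto_mult_right[OF tt, of y] by simp
      qed
      from filterlim_compose[OF lim this]
      have "(\<lambda>m. F (q m) (Complex 0 y)) \<longlonglongrightarrow> 0"
        by (simp add: F_def complex_of_real_mult_Complex)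
      with lg[of "Complex 0 y"] y show ?thesis
        using LIMSEQ_unique by auto
    qed
    have lp: "\<i> islimpt {Complex 0 y | y. y > 0}"
      unfolding islimpt_approachable
    proof (intro allI impI)
      fix d :: real assume "d > 0"
      then show "\<exists>x'\<in>{Complex 0 y |y. 0 < y}. x' \<noteq> \<i> \<and> dist x' \<i> < d"
        by (intro bexI[of _ "Complex 0 (1 + d/2)"])
          (auto simp: complex_eq_iff dist_norm cmod_def)
    qed
    have gz: "g z = 0"
    proof (rule analytic_continuation[OF g oH cH _ _ lp])
      show "{Complex 0 y | y. y > 0} \<subseteq> ?H" by auto
      show "g w = 0" if "w \<in> {Complex 0 y | y. y > 0}" for w
        using that g_axis by blast
    qed (use z in simp_all)
    have "(\<lambda>m. F (q m) z) \<longlonglongrightarrow> 0" using lg[of z] z gz by simp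
    then have "\<forall>\<^sub>F m in sequentially. dist (F (q m) z) 0 < e"
      using e by (simp add: tendsto_iff)
    then obtain m where "dist (F (q m) z) 0 < e"
      using eventually_happens[of _ sequentially] by auto
    then show "\<exists>m. dist (s (of_real (t (r m)) * z)) 0 < e"
      unfolding F_def by blast
  qed
qed

lemma entire_dominated_quotient_constant:
  fixes f g :: "complex \<Rightarrow> complex"
  assumes "f holomorphic_on UNIV" "g holomorphic_on UNIV"
    and nz: "\<And>z. g z \<noteq> 0" and le: "\<And>z. cmod (f z) \<le> cmod (g z)" and f0: "f 0 = 0"
  shows "f z = 0"
proof -
  have "(\<lambda>z. f z / g z) constant_on UNIV"
  proof (rule Liouville_theorem)
    show "(\<lambda>z. f z / g z) holomorphic_on UNIV"
      by (intro holomorphic_intros assms) (use nz in auto)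
    show "bounded (range (\<lambda>z. f z / g z))"
      unfolding bounded_iff
      by (rule exI[of _ 1]) (use nz le in \<open>auto simp: norm_divide divide_le_eq_1\<close>)
  qed
  then obtain c where c: "f z / g z = c" for z by (auto simp: constant_on_def)
  from c[of 0] f0 have "c = 0" by simp
  with c[of z] nz show ?thesis by simp
qed


section \<open>Zeros of functions close to a sine, and labelled eigenvalues\<close>

text \<open>The sine has an unspecified phase \<open>\<gamma>\<close>, because only the distances
  of consecutive zeros matter. Closeness of the values puts every zero near \<open>\<gamma> +
  \<int>\<close> and a zero near every such point; closeness of the derivatives excludes two zeros
  near the same point.\<close>

locale near_sine =
  fixes D D' :: "real \<Rightarrow> real" and \<gamma> R \<epsilon> \<delta> :: real
  assumes deriv_D: "\<And>y. \<bar>y\<bar> \<le> R \<Longrightarrow> (D has_real_derivative D' y) (at y)"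
    and D_close: "\<And>y. \<bar>y\<bar> \<le> R \<Longrightarrow> \<bar>D y - sin (pi * (y - \<gamma>))\<bar> \<le> \<epsilon>"
    and D'_close: "\<And>y. \<bar>y\<bar> \<le> R \<Longrightarrow> \<bar>D' y - pi * cos (pi * (y - \<gamma>))\<bar> \<le> \<epsilon>"
    and \<delta>: "0 < \<delta>" "\<delta> \<le> 1/4"
    and \<epsilon>: "\<epsilon> < sin (pi * \<delta>)" "\<epsilon> < 1"
begin

lemma zero_near_lattice:
  assumes y: "\<bar>y\<bar> \<le> R" and D0: "D y = 0"
  obtains m :: int where "\<bar>y - \<gamma> - of_int m\<bar> < \<delta>"
proof -
  define m where "m = round (y - \<gamma>)"
  define x where "x = y - \<gamma> - of_int m"
  have x: "\<bar>x\<bar> \<le> 1/2"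
    using of_int_round_abs_le[of "y - \<gamma>"] by (simp add: x_def m_def abs_minus_commute)
  have eq: "pi * (y - \<gamma>) = pi * x + pi * of_int m" by (simp add: x_def algebra_simps)
  have s0: "sin (pi * real_of_int m) = 0" by (simp add: sin_zero_iff_int2 mult.commute)
  have c1: "\<bar>cos (pi * real_of_int m)\<bar> = 1"
    using sin_cos_squared_add[of "pi * real_of_int m"] s0 by (simp add: power2_eq_1_iff)
  have "\<bar>sin (pi * (y - \<gamma>))\<bar> = \<bar>sin (pi * x)\<bar>"
    unfolding eq sin_add s0 by (simp add: abs_mult c1)
  also have "\<bar>sin (pi * x)\<bar> = sin (pi * \<bar>x\<bar>)"
  proof -
    have "sin (pi * \<bar>x\<bar>) \<ge> 0" using x by (intro sin_ge_zero) auto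
    then show ?thesis by (cases "x \<ge> 0") auto
  qed
  finally have "sin (pi * \<bar>x\<bar>) \<le> \<epsilon>" using D_close[OF y] D0 by simp
  then have lt: "sin (pi * \<bar>x\<bar>) < sin (pi * \<delta>)" using \<epsilon> by simp
  have "\<bar>x\<bar> < \<delta>"
  proof (rule ccontr)
    assume "\<not> \<bar>x\<bar> < \<delta>"
    then have "sin (pi * \<delta>) \<le> sin (pi * \<bar>x\<bar>)"
      using x \<delta> by (intro sin_monotone_2pi_le) (auto intro: order_trans[of _ 0])
    with lt show False by simp
  qed
  then show ?thesis using that[of m] by (simp add: x_def)
qed

lemma zero_in_lattice_interval:
  assumes lo: "-R \<le> \<gamma> + of_int m - \<delta>" and hi: "\<gamma> + of_int m + \<delta> \<le> R"
  obtains y where "\<gamma> + of_int m - \<delta> \<le> y" "y \<le> \<gamma> + of_int m + \<delta>" "D y = 0"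
proof -
  define c where "c = cos (pi * real_of_int m)"
  have s0: "sin (pi * real_of_int m) = 0" by (simp add: sin_zero_iff_int2 mult.commute)
  have c1: "c = 1 \<or> c = -1"
    using sin_cos_squared_add[of "pi * real_of_int m"] s0 by (simp add: power2_eq_1_iff c_def)
  let ?l = "\<gamma> + of_int m - \<delta>" and ?r = "\<gamma> + of_int m + \<delta>"
  have 1: "pi * (?l - \<gamma>) = pi * of_int m - pi * \<delta>" "pi * (?r - \<gamma>) = pi * of_int m + pi * \<delta>"
    by (simp_all add: algebra_simps)
  have vl: "sin (pi * (?l - \<gamma>)) = - c * sin (pi * \<delta>)" and vr: "sin (pi * (?r - \<gamma>)) = c * sin (pi * \<delta>)"
    unfolding 1 sin_add sin_diff s0 by (simp_all add: c_def)
  have bl: "\<bar>?l\<bar> \<le> R" and br: "\<bar>?r\<bar> \<le> R" using lo hi \<delta> by linarith+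
  have sl: "c * D ?l \<le> 0" and sr: "c * D ?r \<ge> 0"
    using D_close[OF bl] D_close[OF br] c1 \<epsilon> unfolding vl vr by auto
  have cont: "continuous_on {?l..?r} (\<lambda>y. c * D y)"
  proof (intro continuous_intros continuous_at_imp_continuous_on ballI)
    fix y assume "y \<in> {?l..?r}"
    then have "\<bar>y\<bar> \<le> R" using lo hi by auto
    then show "isCont D y" using deriv_D DERIV_isCont by blast
  qed
  obtain y where "?l \<le> y" "y \<le> ?r" "c * D y = 0"
    using IVT'[of "\<lambda>y. c * D y" ?l 0 ?r, OF sl sr _ cont] \<delta> by auto
  then show ?thesis using that c1 by auto
qed

lemma zeros_separated:
  assumes "\<bar>y1\<bar> \<le> R" "\<bar>y2\<bar> \<le> R" "y1 < y2" "D y1 = 0" "D y2 = 0"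
  shows "y2 - y1 > 1 - 2 * \<delta>"
proof -
  obtain m1 :: int where m1: "\<bar>y1 - \<gamma> - of_int m1\<bar> < \<delta>"
    using zero_near_lattice assms by blast
  obtain m2 :: int where m2: "\<bar>y2 - \<gamma> - of_int m2\<bar> < \<delta>"
    using zero_near_lattice assms by blast
  have "m1 \<noteq> m2"
  proof
    assume eq: "m1 = m2"
    have "(D has_real_derivative D' y) (at y)" if "y1 \<le> y" "y \<le> y2" for y
      using that assms(1,2) by (intro deriv_D) linarith
    then obtain \<zeta> where z: "y1 < \<zeta>" "\<zeta> < y2" "D y2 - D y1 = (y2 - y1) * D' \<zeta>"
      using MVT2[OF assms(3), of D D'] by blast
    have D'0: "D' \<zeta> = 0" using z assms by auto
    define x where "x = \<zeta> - \<gamma> - of_int m1"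
    have x: "\<bar>x\<bar> \<le> 1/4" using m1 m2 z \<delta> unfolding eq x_def by linarith
    have e: "pi * (\<zeta> - \<gamma>) = pi * x + pi * of_int m1" by (simp add: x_def algebra_simps)
    have s0: "sin (pi * real_of_int m1) = 0" by (simp add: sin_zero_iff_int2 mult.commute)
    have c1: "\<bar>cos (pi * real_of_int m1)\<bar> = 1"
      using sin_cos_squared_add[of "pi * real_of_int m1"] s0 by (simp add: power2_eq_1_iff)
    have "\<bar>cos (pi * (\<zeta> - \<gamma>))\<bar> = \<bar>cos (pi * x)\<bar>"
      unfolding e cos_add s0 by (simp add: abs_mult c1)
    also have "cos (pi * x) = cos (pi * \<bar>x\<bar>)" by (cases "x \<ge> 0") auto
    (* Between two zeros near the same lattice point the derivative vanishes; but there the cosine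
       is at least 1/2 in modulus. *)
    also have "\<bar>cos (pi * \<bar>x\<bar>)\<bar> \<ge> cos (pi / 3)"
    proof -
      have "pi * \<bar>x\<bar> \<le> pi * (1/4)" using x by (intro mult_left_mono) auto
      then have "cos (pi / 3) \<le> cos (pi * \<bar>x\<bar>)"
        by (intro cos_monotone_0_pi_le) auto
      then show ?thesis by linarith
    qed
    finally have "\<bar>cos (pi * (\<zeta> - \<gamma>))\<bar> \<ge> 1/2" by (simp add: cos_60)
    then have "pi * \<bar>cos (pi * (\<zeta> - \<gamma>))\<bar> \<ge> pi * (1/2)" by (intro mult_left_mono) auto
    moreover have "\<bar>\<zeta>\<bar> \<le> R" using z assms by linarith
    from D'_close[OF this] have "pi * \<bar>cos (pi * (\<zeta> - \<gamma>))\<bar> \<le> \<epsilon>"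
      by (simp add: D'0 abs_mult)
    ultimately show False using \<epsilon> pi_gt3 by linarith
  qed
  moreover have "m1 \<le> m2"
  proof -
    have "real_of_int m1 < real_of_int m2 + 1" using m1 m2 assms \<delta> by linarith
    then show ?thesis by linarith
  qed
  ultimately have "real_of_int m1 + 1 \<le> real_of_int m2" by linarith
  then show ?thesis using m1 m2 by linarith
qed

lemma next_zero:
  assumes y1: "- R \<le> y1" "y1 + 2 \<le> R" "D y1 = 0"
  obtains y2 where "y1 < y2" "y2 \<le> y1 + 1 + 2 * \<delta>" "D y2 = 0"
proof -
  have "\<bar>y1\<bar> \<le> R" using y1 by linarith
  then obtain m :: int where m: "\<bar>y1 - \<gamma> - of_int m\<bar> < \<delta>"
    using zero_near_lattice y1 by blast
  have "- R \<le> \<gamma> + of_int (m + 1) - \<delta>" "\<gamma> + of_int (m + 1) + \<delta> \<le> R"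
    using m y1 \<delta> by (simp_all add: abs_if split: if_splits)
  then obtain y where "\<gamma> + of_int (m + 1) - \<delta> \<le> y" "y \<le> \<gamma> + of_int (m + 1) + \<delta>" "D y = 0"
    by (rule zero_in_lattice_interval)
  then show ?thesis using that[of y] m \<delta> by (simp add: abs_if split: if_splits)
qed

lemma zero_in_interval:
  assumes p: "- R \<le> p" "p + 2 \<le> R"
  obtains y where "p \<le> y" "y < p + 2" "D y = 0"
proof -
  define m where "m = \<lceil>p - \<gamma> + 1/4\<rceil>"
  have m: "p - \<gamma> + 1/4 \<le> of_int m" "of_int m < p - \<gamma> + 1/4 + 1"
    unfolding m_def by linarith+
  have "- R \<le> \<gamma> + of_int m - \<delta>" "\<gamma> + of_int m + \<delta> \<le> R" using m p \<delta> by linarith+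
  then obtain y where "\<gamma> + of_int m - \<delta> \<le> y" "y \<le> \<gamma> + of_int m + \<delta>" "D y = 0"
    by (rule zero_in_lattice_interval)
  then show ?thesis using that[of y] m \<delta> by linarith
qed

end

lemma exists_element_of_rank:
  fixes E :: "real set"
  assumes "finite E" "i < card E"
  shows "\<exists>x\<in>E. card {y \<in> E. y < x} = i"
  using assms
proof (induction arbitrary: i rule: finite_linorder_max_induct)
  case (insert b A)
  have nb: "b \<notin> A" using insert.hyps by auto
  show ?case
  proof (cases "i < card A")
    case True
    then obtain x where x: "x \<in> A" "card {y \<in> A. y < x} = i" using insert.IH by blast
    have "{y \<in> insert b A. y < x} = {y \<in> A. y < x}" using x insert.hyps by force
    with x show ?thesis by (intro bexI[of _ x]) auto
  next
    case False
    then have "i = card A" using insert nb by simp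
    moreover have "{y \<in> insert b A. y < b} = A" using insert.hyps by auto
    ultimately show ?thesis by auto
  qed
qed simp

text \<open>Counting from below, from the smallest eigenvalue on, removes the case distinction at
  the reference point \<open>\<xi>\<close>: raising the label by one always raises the rank by
  one.\<close>

lemma is_labelled_eig_iff_rank:
  fixes a b :: "int \<Rightarrow> real"
  defines "E k n \<equiv> {y. eigenvalue (jacobi_trunc a b k n) y}"
  assumes fin: "finite (E k n)"
  shows "is_labelled_eig a b \<xi> k n j x \<longleftrightarrow>
    x \<in> E k n \<and> int (card {y \<in> E k n. y < x}) = int (card {y \<in> E k n. y < \<xi>}) + j - 1"
proof (cases "\<xi> \<le> x")
  case True
  let ?E = "E k n"
  have "card {y \<in> ?E. y < x} = card ({y \<in> ?E. y < \<xi>} \<union> {y \<in> ?E. \<xi> \<le> y \<and> y < x})"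
    using True by (intro arg_cong[where f = card]) auto
  also have "\<dots> = card {y \<in> ?E. y < \<xi>} + card {y \<in> ?E. \<xi> \<le> y \<and> y < x}"
    by (rule card_Un_disjoint) (use fin in auto)
  finally show ?thesis using True unfolding is_labelled_eig_def by (auto simp: E_def)
next
  case False
  let ?E = "E k n"
  show ?thesis
  proof (cases "x \<in> ?E")
    case x: True
    have "card {y \<in> ?E. y < \<xi>} = card ({y \<in> ?E. y < x} \<union> insert x {y \<in> ?E. x < y \<and> y < \<xi>})"
      using False x by (intro arg_cong[where f = card]) auto
    also have "\<dots> = card {y \<in> ?E. y < x} + card (insert x {y \<in> ?E. x < y \<and> y < \<xi>})"
      by (rule card_Un_disjoint) (use fin in auto)
    also have "card (insert x {y \<in> ?E. x < y \<and> y < \<xi>}) = Suc (card {y \<in> ?E. x < y \<and> y < \<xi>})"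
      using fin by simp
    finally show ?thesis using False x unfolding is_labelled_eig_def by (auto simp: E_def)
  qed (auto simp: is_labelled_eig_def E_def)
qed

text \<open>The zeros of \<open>D\<close> within \<open>[-R, R]\<close> are the rescaled
  eigenvalues there. Every interval of length \<open>2\<close> contains a zero, so the eigenvalues
  labelled \<open>j\<close> and \<open>j + 1\<close> exist and lie well inside this window once
  \<open>R\<close> exceeds a multiple of \<open>\<bar>j\<bar>\<close>, where they are consecutive
  zeros.\<close>

lemma (in near_sine) labelled_eig_spacing:
  fixes a b :: "int \<Rightarrow> real" and j k n :: int
  defines "E \<equiv> {y. eigenvalue (jacobi_trunc a b k n) y}"
  assumes fin: "finite E" and \<tau>: "\<tau> > 0"
    and eig: "\<And>y. \<bar>y\<bar> \<le> R \<Longrightarrow> \<xi> + y / \<tau> \<in> E \<longleftrightarrow> D y = 0"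
    and R: "R \<ge> 2 * \<bar>of_int j\<bar> + 4"
  shows "(\<exists>x. is_labelled_eig a b \<xi> k n j x) \<and> (\<exists>x. is_labelled_eig a b \<xi> k n (j + 1) x) \<and>
    \<bar>\<tau> * (labelled_eig a b \<xi> k n (j + 1) - labelled_eig a b \<xi> k n j) - 1\<bar> \<le> 2 * \<delta>"
proof -
  let ?rk = "\<lambda>x. card {y \<in> E. y < x}"
  have lab: "is_labelled_eig a b \<xi> k n i x \<longleftrightarrow> x \<in> E \<and> int (?rk x) = int (?rk \<xi>) + i - 1" for i x
    using is_labelled_eig_iff_rank[of a b k n \<xi> i x, folded E_def, OF fin] .
  have rk_less: "?rk x < ?rk x'" if "x \<in> E" "x < x'" for x x'
    by (intro psubset_card_mono) (use that fin in auto)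
  have uniq: "x = x'" if "x \<in> E" "x' \<in> E" "?rk x = ?rk x'" for x x'
    using rk_less[of x x'] rk_less[of x' x] that by (cases x x' rule: linorder_cases) auto
  have lab_the: "labelled_eig a b \<xi> k n i = x" if "is_labelled_eig a b \<xi> k n i x" for i x
    unfolding labelled_eig_def
  proof (rule the_equality)
    show "is_labelled_eig a b \<xi> k n i x" by (rule that)
    fix x' assume "is_labelled_eig a b \<xi> k n i x'"
    with that show "x' = x" unfolding lab by (intro uniq) auto
  qed
  have many: "J \<le> card {x \<in> E. \<xi> + p / \<tau> \<le> x \<and> x < \<xi> + (p + 2 * real J) / \<tau>}"
    if "- R \<le> p" "p + 2 * real J \<le> R" for p J
    using that
  proof (induction J)
    case (Suc J)
    let ?S = "\<lambda>J. {x \<in> E. \<xi> + p / \<tau> \<le> x \<and> x < \<xi> + (p + 2 * real J) / \<tau>}"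
    obtain y where y: "p + 2 * real J \<le> y" "y < p + 2 * real J + 2" "D y = 0"
      by (rule zero_in_interval[of "p + 2 * real J"]) (use Suc.prems in auto)
    have yE: "\<xi> + y / \<tau> \<in> E" using eig[of y] y Suc.prems by auto
    have "\<xi> + p / \<tau> \<le> \<xi> + y / \<tau>" "\<xi> + y / \<tau> < \<xi> + (p + 2 * real (Suc J)) / \<tau>"
      "\<xi> + (p + 2 * real J) / \<tau> \<le> \<xi> + (p + 2 * real (Suc J)) / \<tau>"
      using y \<tau> by (auto intro!: divide_right_mono divide_strict_right_mono)
    then have "insert (\<xi> + y / \<tau>) (?S J) \<subseteq> ?S (Suc J)"
      using yE by fastforce
    moreover have "\<xi> + y / \<tau> \<notin> ?S J" using y \<tau> by (simp add: divide_less_cancel not_less)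
    ultimately have "Suc (card (?S J)) \<le> card (?S (Suc J))"
      using fin card_mono[of "?S (Suc J)" "insert (\<xi> + y / \<tau>) (?S J)"] by simp
    with Suc show ?case by simp
  qed simp
  define J where "J = nat \<bar>j\<bar> + 1"
  have J: "real J = \<bar>of_int j\<bar> + 1" "int J = \<bar>j\<bar> + 1" by (simp_all add: J_def)
  have up: "J \<le> card {x \<in> E. \<xi> \<le> x \<and> x < \<xi> + 2 * real J / \<tau>}"
  proof -
    have "J \<le> card {x \<in> E. \<xi> + 0 / \<tau> \<le> x \<and> x < \<xi> + (0 + 2 * real J) / \<tau>}"
      by (rule many) (use R J(1) in linarith)+
    then show ?thesis by simp
  qed
  have dn: "J \<le> card {x \<in> E. \<xi> - 2 * real J / \<tau> \<le> x \<and> x < \<xi>}"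
  proof -
    have "J \<le> card {x \<in> E. \<xi> + (- 2 * real J) / \<tau> \<le> x \<and> x < \<xi> + (- 2 * real J + 2 * real J) / \<tau>}"
      by (rule many) (use R J(1) in linarith)+
    then show ?thesis by simp
  qed
  have rk\<xi>: "J \<le> ?rk \<xi>"
  proof -
    have "card {x \<in> E. \<xi> - 2 * real J / \<tau> \<le> x \<and> x < \<xi>} \<le> ?rk \<xi>"
      by (intro card_mono) (use fin in auto)
    with dn show ?thesis by linarith
  qed
  have "card ({x \<in> E. x < \<xi>} \<union> {x \<in> E. \<xi> \<le> x \<and> x < \<xi> + 2 * real J / \<tau>}) \<le> card E"
    by (intro card_mono) (use fin in auto)
  moreover have "card ({x \<in> E. x < \<xi>} \<union> {x \<in> E. \<xi> \<le> x \<and> x < \<xi> + 2 * real J / \<tau>}) =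
      ?rk \<xi> + card {x \<in> E. \<xi> \<le> x \<and> x < \<xi> + 2 * real J / \<tau>}"
    by (intro card_Un_disjoint) (use fin in auto)
  ultimately have cE: "?rk \<xi> + J \<le> card E" using up by linarith
  have ex: "\<exists>x. is_labelled_eig a b \<xi> k n i x" if "i = j \<or> i = j + 1" for i
  proof -
    define r where "r = nat (int (?rk \<xi>) + i - 1)"
    have "int (?rk \<xi>) + i - 1 \<ge> 0" using rk\<xi> J that by linarith
    moreover have "int (?rk \<xi>) + i - 1 < int (card E)" using cE J that by linarith
    ultimately have "r < card E" "int r = int (?rk \<xi>) + i - 1" by (auto simp: r_def)
    then show ?thesis using exists_element_of_rank[OF fin] unfolding lab by metis
  qed
  obtain x0 where x0: "is_labelled_eig a b \<xi> k n j x0" using ex by blast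
  obtain x1 where x1: "is_labelled_eig a b \<xi> k n (j + 1) x1" using ex by blast
  have x0E: "x0 \<in> E" "x1 \<in> E" and rk01: "?rk x1 = ?rk x0 + 1"
    and rk0: "int (?rk x0) = int (?rk \<xi>) + j - 1"
    using x0 x1 unfolding lab by auto
  have x01: "x0 < x1"
    using rk01 rk_less[of x1 x0] x0E by (cases x0 x1 rule: linorder_cases) auto
  have hi: "x0 < \<xi> + 2 * real J / \<tau>"
  proof (rule ccontr)
    assume "\<not> x0 < \<xi> + 2 * real J / \<tau>"
    moreover have "\<xi> \<le> \<xi> + 2 * real J / \<tau>" using \<tau> by simp
    ultimately have "card ({x \<in> E. x < \<xi>} \<union> {x \<in> E. \<xi> \<le> x \<and> x < \<xi> + 2 * real J / \<tau>}) \<le> ?rk x0"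
      by (intro card_mono) (use fin in auto)
    moreover have "card ({x \<in> E. x < \<xi>} \<union> {x \<in> E. \<xi> \<le> x \<and> x < \<xi> + 2 * real J / \<tau>}) =
        ?rk \<xi> + card {x \<in> E. \<xi> \<le> x \<and> x < \<xi> + 2 * real J / \<tau>}"
      by (intro card_Un_disjoint) (use fin in auto)
    ultimately show False using up rk0 J by linarith
  qed
  have lo: "\<xi> - 2 * real J / \<tau> \<le> x0"
  proof (rule ccontr)
    assume "\<not> \<xi> - 2 * real J / \<tau> \<le> x0"
    moreover have "\<xi> - 2 * real J / \<tau> \<le> \<xi>" using \<tau> by simp
    ultimately have "card (insert x0 {x \<in> E. x < x0} \<union> {x \<in> E. \<xi> - 2 * real J / \<tau> \<le> x \<and> x < \<xi>}) \<le> ?rk \<xi>"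
      using x0E by (intro card_mono) (use fin in auto)
    moreover have "card (insert x0 {x \<in> E. x < x0} \<union> {x \<in> E. \<xi> - 2 * real J / \<tau> \<le> x \<and> x < \<xi>}) =
        card (insert x0 {x \<in> E. x < x0}) + card {x \<in> E. \<xi> - 2 * real J / \<tau> \<le> x \<and> x < \<xi>}"
      using \<open>\<not> \<xi> - 2 * real J / \<tau> \<le> x0\<close> by (intro card_Un_disjoint) (use fin in auto)
    moreover have "card (insert x0 {x \<in> E. x < x0}) = Suc (?rk x0)"
      using fin by simp
    ultimately show False using dn rk0 J by linarith
  qed
  define y0 where "y0 = \<tau> * (x0 - \<xi>)"
  define y1 where "y1 = \<tau> * (x1 - \<xi>)"
  have xy: "x0 = \<xi> + y0 / \<tau>" "x1 = \<xi> + y1 / \<tau>" using \<tau> by (auto simp: y0_def y1_def)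
  have y0b: "- 2 * real J \<le> y0" "y0 < 2 * real J"
  proof -
    have "\<tau> * (- (2 * real J / \<tau>)) \<le> y0" "y0 < \<tau> * (2 * real J / \<tau>)"
      unfolding y0_def using hi lo \<tau> by (intro mult_left_mono mult_strict_left_mono; linarith)+
    then show "- 2 * real J \<le> y0" "y0 < 2 * real J" using \<tau> by simp_all
  qed
  have y0R: "\<bar>y0\<bar> \<le> R" "y0 + 2 \<le> R" using y0b R J by linarith+
  have D0: "D y0 = 0" using eig[OF y0R(1)] x0E xy by simp
  obtain y2 where y2: "y0 < y2" "y2 \<le> y0 + 1 + 2 * \<delta>" "D y2 = 0"
    by (rule next_zero[of y0]) (use y0R D0 in auto)
  have y2R: "\<bar>y2\<bar> \<le> R" using y2 y0R \<delta> by linarith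
  have x2E: "\<xi> + y2 / \<tau> \<in> E" using eig[OF y2R] y2 by simp
  have x12: "x1 \<le> \<xi> + y2 / \<tau>"
  proof (rule ccontr)
    assume *: "\<not> x1 \<le> \<xi> + y2 / \<tau>"
    have "x0 < \<xi> + y2 / \<tau>" using y2 \<tau> xy by (simp add: divide_less_cancel)
    then have "?rk x0 < ?rk (\<xi> + y2 / \<tau>)" "?rk (\<xi> + y2 / \<tau>) < ?rk x1"
      using rk_less x0E x2E * by auto
    with rk01 show False by simp
  qed
  have y12: "y1 \<le> y2" using x12 \<tau> unfolding xy by (simp add: divide_le_cancel)
  have y01: "y0 < y1" using x01 \<tau> unfolding xy by (simp add: divide_less_cancel)
  have y1R: "\<bar>y1\<bar> \<le> R" using y01 y12 y0R y2R by linarith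
  have D1: "D y1 = 0" using eig[OF y1R] x0E xy by simp
  have "y1 - y0 > 1 - 2 * \<delta>" by (rule zeros_separated[OF y0R(1) y1R y01 D0 D1])
  moreover have "y1 - y0 \<le> 1 + 2 * \<delta>" using y12 y2 by linarith
  moreover have "\<tau> * (x1 - x0) = y1 - y0" by (simp add: y0_def y1_def algebra_simps)
  ultimately have "\<bar>\<tau> * (x1 - x0) - 1\<bar> \<le> 2 * \<delta>" by linarith
  with lab_the[OF x0] lab_the[OF x1] x0 x1 show ?thesis by auto
qed


section \<open>Perturbing the energy: variation of constants\<close>

lemma int_step_constant:
  fixes f :: "int \<Rightarrow> 'a"
  assumes "\<And>n. f n = f (n - 1)"
  shows "f n = f m"
proof -
  have "f n = f 0" for n
  proof (induction n rule: int_induct[where k = 0])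
    case (step1 i)
    then show ?case using assms[of "i + 1"] by simp
  next
    case (step2 i)
    then show ?case using assms[of i] by simp
  qed simp
  then show ?thesis by metis
qed

text \<open>Green's identity for one step.\<close>

lemma wronskian_step:
  assumes "jacobi a b u n = E * u n" "jacobi a b v n = F * v n"
  shows "wronskian a u v n = wronskian a u v (n - 1) + (E - F) * u n * v n"
proof -
  have "wronskian a u v n - wronskian a u v (n - 1) = jacobi a b u n * v n - u n * jacobi a b v n"
    by (simp add: wronskian_def jacobi_def algebra_simps)
  then show ?thesis unfolding assms by (simp add: algebra_simps)
qed

text \<open>Since the Wronskian of \<open>cnj \<circ> \<psi>\<close> and \<open>\<psi>\<close> does
  not vanish, these two sequences form a basis of the solutions at energy \<open>\<xi>\<close>. Its
  sign singles out \<open>\<psi>\<close> among the two.\<close>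

locale jacobi_solution =
  fixes a b :: "int \<Rightarrow> real" and \<xi> :: real and \<psi> :: "int \<Rightarrow> complex"
  assumes a_pos: "\<And>i. a i > 0"
    and psi_solution: "\<And>i. jacobi a b \<psi> i = of_real \<xi> * \<psi> i"
    and wronskian_pos: "Im (wronskian a (\<lambda>m. cnj (\<psi> m)) \<psi> 0) > 0"
begin

definition w :: real where "w = Im (wronskian a (\<lambda>m. cnj (\<psi> m)) \<psi> 0)"

lemma w_pos: "w > 0" using wronskian_pos by (simp add: w_def)

lemma psi_cnj_solution: "jacobi a b (\<lambda>m. cnj (\<psi> m)) i = of_real \<xi> * cnj (\<psi> i)"
proof -
  have "jacobi a b (\<lambda>m. cnj (\<psi> m)) i = cnj (jacobi a b \<psi> i)" by (simp add: jacobi_def)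
  also have "\<dots> = of_real \<xi> * cnj (\<psi> i)" unfolding psi_solution by simp
  finally show ?thesis .
qed

lemma wronskian_psi: "wronskian a (\<lambda>m. cnj (\<psi> m)) \<psi> n = \<i> * of_real w"
proof -
  have "wronskian a (\<lambda>m. cnj (\<psi> m)) \<psi> n = wronskian a (\<lambda>m. cnj (\<psi> m)) \<psi> 0"
    by (rule int_step_constant[of "wronskian a (\<lambda>m. cnj (\<psi> m)) \<psi>"],
        subst wronskian_step[OF psi_cnj_solution psi_solution]) simp
  also have "\<dots> = \<i> * of_real w"
    unfolding w_def by (simp add: wronskian_def complex_eq_iff algebra_simps)
  finally show ?thesis .
qed

lemma psi_nonzero: "\<psi> n \<noteq> 0"
  using wronskian_psi[of n] w_pos by (auto simp: wronskian_def)

definition cc :: "int \<Rightarrow> real" where "cc n = scale_c a \<psi> 0 n"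

lemma scale_c_sum:
  assumes "k \<le> n" shows "scale_c a \<psi> k n = (\<Sum>j=k+1..n. (cmod (\<psi> j))\<^sup>2) / (pi * w)"
  unfolding scale_c_def Let_def wronskian_psi using assms w_pos
  by (simp add: Re_divide_of_real flip: of_real_mult)

lemma cc_step: "cc n = cc (n - 1) + (cmod (\<psi> n))\<^sup>2 / (pi * w)"
proof (cases "n \<ge> 1")
  case True
  then have "{0 + 1..n} = insert n {0 + 1..n - 1}" by auto
  then have "(\<Sum>j=0+1..n. (cmod (\<psi> j))\<^sup>2) = (cmod (\<psi> n))\<^sup>2 + (\<Sum>j=0+1..n-1. (cmod (\<psi> j))\<^sup>2)"
    by (simp only: sum.insert finite_atLeastAtMost_int) auto
  then show ?thesis using True by (simp add: cc_def scale_c_sum add_divide_distrib)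
next
  case False
  have neg: "cc m = - ((\<Sum>j=m+1..0. (cmod (\<psi> j))\<^sup>2) / (pi * w))" if "m \<le> 0" for m
    using that scale_c_sum[of m 0] scale_c_sum[of 0 0]
    by (cases "m = 0") (simp_all add: cc_def scale_c_def Let_def)
  have "{n - 1 + 1..0} = insert n {n + 1..0}" using False by auto
  then have "(\<Sum>j=n-1+1..0. (cmod (\<psi> j))\<^sup>2) = (cmod (\<psi> n))\<^sup>2 + (\<Sum>j=n+1..0. (cmod (\<psi> j))\<^sup>2)"
    by (simp only: sum.insert finite_atLeastAtMost_int) auto
  then show ?thesis using False neg[of n] neg[of "n - 1"] by (simp add: add_divide_distrib)
qed

lemma cc_0: "cc 0 = 0" by (simp add: cc_def scale_c_sum)

lemma scale_c_diff:
  assumes "k \<le> n" shows "scale_c a \<psi> k n = cc n - cc k"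
  using assms
proof (induction n rule: int_ge_induct)
  case base
  then show ?case by (simp add: scale_c_sum)
next
  case (step i)
  then have "{k + 1..i + 1} = insert (i + 1) {k + 1..i}" by auto
  then have "(\<Sum>j=k+1..i+1. (cmod (\<psi> j))\<^sup>2) = (cmod (\<psi> (i+1)))\<^sup>2 + (\<Sum>j=k+1..i. (cmod (\<psi> j))\<^sup>2)"
    by (simp only: sum.insert finite_atLeastAtMost_int) auto
  with step show ?case using cc_step[of "i + 1"] by (simp add: scale_c_sum add_divide_distrib)
qed

lemma cc_strict_mono: "strict_mono cc"
proof (rule strict_monoI)
  fix k n :: int assume kn: "k < n"
  have "0 < (\<Sum>j=k+1..n. (cmod (\<psi> j))\<^sup>2)"
    by (intro sum_pos) (use kn psi_nonzero in auto)
  then have "scale_c a \<psi> k n > 0" using kn w_pos by (simp add: scale_c_sum)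
  then show "cc k < cc n" using kn by (simp add: scale_c_diff)
qed

lemma cc_mono: "k \<le> n \<Longrightarrow> cc k \<le> cc n"
  using cc_strict_mono by (simp add: strict_mono_less_eq)

lemma cc_pos: "n > 0 \<Longrightarrow> cc n > 0"
  using strict_monoD[OF cc_strict_mono, of 0 n] by (simp add: cc_0)


text \<open>The recursion satisfied by the coefficients \<open>\<alpha>\<close>,
  \<open>\<beta>\<close> of a solution at energy \<open>\<xi> + z\<close> in the basis
  \<open>\<psi>\<close>, \<open>cnj \<circ> \<psi>\<close>, if \<open>\<alpha> n\<close> and
  \<open>\<beta> n\<close> are chosen to reproduce it at the sites \<open>n\<close> and \<open>n +
  1\<close>. In this basis the expected limit of the transfer matrices is diagonal.\<close>

definition flow :: "complex \<Rightarrow> (int \<Rightarrow> complex) \<Rightarrow> (int \<Rightarrow> complex) \<Rightarrow> bool" where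
  "flow z \<alpha> \<beta> \<longleftrightarrow> (\<forall>n.
     \<alpha> n = \<alpha> (n - 1) + \<i> * z / of_real w * cnj (\<psi> n) * (\<psi> n * \<alpha> (n - 1) + cnj (\<psi> n) * \<beta> (n - 1)) \<and>
     \<beta> n = \<beta> (n - 1) - \<i> * z / of_real w * \<psi> n * (\<psi> n * \<alpha> (n - 1) + cnj (\<psi> n) * \<beta> (n - 1)))"

definition synth :: "(int \<Rightarrow> complex) \<Rightarrow> (int \<Rightarrow> complex) \<Rightarrow> int \<Rightarrow> complex" where
  "synth \<alpha> \<beta> n = \<psi> n * \<alpha> n + cnj (\<psi> n) * \<beta> n"

text \<open>The corrections to \<open>\<alpha>\<close> and \<open>\<beta>\<close> at site
  \<open>n\<close> cancel in the value at \<open>n\<close>: they only change its successor.\<close>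

lemma synth_prev:
  assumes "flow z \<alpha> \<beta>"
  shows "synth \<alpha> \<beta> n = \<psi> n * \<alpha> (n - 1) + cnj (\<psi> n) * \<beta> (n - 1)"
proof -
  let ?u = "\<psi> n * \<alpha> (n - 1) + cnj (\<psi> n) * \<beta> (n - 1)"
  have "\<alpha> n = \<alpha> (n - 1) + \<i> * z / of_real w * cnj (\<psi> n) * ?u"
    "\<beta> n = \<beta> (n - 1) - \<i> * z / of_real w * \<psi> n * ?u"
    using assms unfolding flow_def by blast+
  then have "synth \<alpha> \<beta> n = ?u + (\<psi> n * (\<i> * z / of_real w * cnj (\<psi> n) * ?u)
      - cnj (\<psi> n) * (\<i> * z / of_real w * \<psi> n * ?u))"
    unfolding synth_def by (simp only:) (simp add: algebra_simps)
  also have "\<dots> = ?u" by (simp add: mult_ac)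
  finally show ?thesis .
qed

lemma flow_step:
  assumes "flow z \<alpha> \<beta>"
  shows "\<alpha> n = \<alpha> (n - 1) + \<i> * z / of_real w * cnj (\<psi> n) * synth \<alpha> \<beta> n"
    and "\<beta> n = \<beta> (n - 1) - \<i> * z / of_real w * \<psi> n * synth \<alpha> \<beta> n"
  unfolding synth_prev[OF assms] using assms unfolding flow_def by blast+

lemma jacobi_synth:
  assumes fl: "flow z \<alpha> \<beta>"
  shows "jacobi a b (synth \<alpha> \<beta>) n = (of_real \<xi> + z) * synth \<alpha> \<beta> n"
proof -
  let ?\<kappa> = "\<i> * z / of_real w" and ?u = "synth \<alpha> \<beta> n"
  have next_val: "synth \<alpha> \<beta> (n + 1) = \<psi> (n + 1) * \<alpha> n + cnj (\<psi> (n + 1)) * \<beta> n"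
    using synth_prev[OF fl, of "n + 1"] by simp
  have "jacobi a b (synth \<alpha> \<beta>) n =
      \<alpha> (n - 1) * jacobi a b \<psi> n + \<beta> (n - 1) * jacobi a b (\<lambda>m. cnj (\<psi> m)) n
      - ?\<kappa> * wronskian a (\<lambda>m. cnj (\<psi> m)) \<psi> n * ?u"
    unfolding jacobi_def wronskian_def next_val
    unfolding flow_step[OF fl, of n] synth_prev[OF fl, of n] unfolding synth_def[of \<alpha> \<beta> "n - 1"]
    by (simp add: algebra_simps add_divide_distrib)
  also have "\<dots> = of_real \<xi> * (\<psi> n * \<alpha> (n - 1) + cnj (\<psi> n) * \<beta> (n - 1)) + z * ?u"
    unfolding psi_solution psi_cnj_solution wronskian_psi using w_pos
    by (simp add: algebra_simps)
  also have "\<dots> = (of_real \<xi> + z) * ?u"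
    using synth_prev[OF fl, of n] by (simp add: algebra_simps)
  finally show ?thesis .
qed

text \<open>Green's identity for a solution and its conjugate, as the Wronskian form is
  \<open>\<bar>\<alpha>\<bar>\<^sup>2 - \<bar>\<beta>\<bar>\<^sup>2\<close> in these coordinates.
  The form decreases along the sites in the upper half-plane and increases in the lower
  one.\<close>

lemma flow_energy_step:
  assumes fl: "flow z \<alpha> \<beta>"
  shows "(cmod (\<alpha> n))\<^sup>2 - (cmod (\<beta> n))\<^sup>2 =
    (cmod (\<alpha> (n - 1)))\<^sup>2 - (cmod (\<beta> (n - 1)))\<^sup>2 - 2 * Im z / w * (cmod (synth \<alpha> \<beta> n))\<^sup>2"
proof -
  let ?\<kappa> = "\<i> * z / of_real w" and ?u = "synth \<alpha> \<beta> n"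
  define x y p \<kappa> u where "x = \<alpha> (n - 1)" and "y = \<beta> (n - 1)" and "p = \<psi> n" and "\<kappa> = ?\<kappa>" and "u = ?u"
  have ueq: "u = p * x + cnj p * y" using synth_prev[OF fl, of n] by (simp add: x_def y_def p_def u_def)
  have eqs: "\<alpha> n = x + \<kappa> * cnj p * u" "\<beta> n = y - \<kappa> * p * u"
    using flow_step[OF fl, of n] by (simp_all add: x_def y_def p_def \<kappa>_def u_def)
  have "of_real ((cmod (\<alpha> n))\<^sup>2 - (cmod (\<beta> n))\<^sup>2) =
      \<alpha> n * cnj (\<alpha> n) - \<beta> n * cnj (\<beta> n)" by (simp add: complex_norm_square del: of_real_power)
  also have "\<dots> = x * cnj x - y * cnj y + \<kappa> * u * (p * x + cnj p * y - (p * x + cnj p * y) + cnj p * cnj x + p * cnj y)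
     + cnj \<kappa> * cnj u * (p * x + cnj p * y)"
    unfolding eqs by (simp add: algebra_simps)
  also have "p * x + cnj p * y - (p * x + cnj p * y) + cnj p * cnj x + p * cnj y = cnj u"
    by (simp add: ueq)
  also have "p * x + cnj p * y = u" by (simp add: ueq)
  also have "x * cnj x - y * cnj y + \<kappa> * u * cnj u + cnj \<kappa> * cnj u * u = 
      of_real ((cmod x)\<^sup>2 - (cmod y)\<^sup>2 + 2 * Re \<kappa> * (cmod u)\<^sup>2)"
  proof -
    have "\<kappa> * u * cnj u + cnj \<kappa> * cnj u * u = (\<kappa> + cnj \<kappa>) * (u * cnj u)"
      by (simp add: algebra_simps)
    also have "\<kappa> + cnj \<kappa> = of_real (2 * Re \<kappa>)" by (simp add: complex_add_cnj)
    finally show ?thesis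
      by (simp add: complex_norm_square algebra_simps del: of_real_power)
  qed
  finally have "(cmod (\<alpha> n))\<^sup>2 - (cmod (\<beta> n))\<^sup>2 = (cmod x)\<^sup>2 - (cmod y)\<^sup>2 + 2 * Re \<kappa> * (cmod u)\<^sup>2"
    by (simp only: of_real_eq_iff)
  moreover have "Re \<kappa> = - Im z / w" by (simp add: \<kappa>_def Re_divide_of_real)
  ultimately show ?thesis by (simp add: x_def y_def u_def)
qed

lemma flow_det:
  assumes f1: "flow z \<alpha> \<beta>" and f2: "flow z \<alpha>' \<beta>'"
  shows "\<alpha> n * \<beta>' n - \<beta> n * \<alpha>' n = \<alpha> m * \<beta>' m - \<beta> m * \<alpha>' m"
proof (rule int_step_constant[of "\<lambda>n. \<alpha> n * \<beta>' n - \<beta> n * \<alpha>' n"])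
  fix n
  define x y x' y' p \<kappa> u u' where "x = \<alpha> (n - 1)" and "y = \<beta> (n - 1)" and
    "x' = \<alpha>' (n - 1)" and "y' = \<beta>' (n - 1)" and "p = \<psi> n" and "\<kappa> = \<i> * z / of_real w" and
    "u = synth \<alpha> \<beta> n" and "u' = synth \<alpha>' \<beta>' n"
  have ueq: "u = p * x + cnj p * y" "u' = p * x' + cnj p * y'"
    using synth_prev[OF f1, of n] synth_prev[OF f2, of n]
    by (simp_all add: x_def y_def x'_def y'_def p_def u_def u'_def)
  have eqs: "\<alpha> n = x + \<kappa> * cnj p * u" "\<beta> n = y - \<kappa> * p * u"
    "\<alpha>' n = x' + \<kappa> * cnj p * u'" "\<beta>' n = y' - \<kappa> * p * u'"
    using flow_step[OF f1, of n] flow_step[OF f2, of n]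
    by (simp_all add: x_def y_def x'_def y'_def p_def \<kappa>_def u_def u'_def)
  have "\<alpha> n * \<beta>' n - \<beta> n * \<alpha>' n =
      x * y' - y * x' + \<kappa> * (u * (p * x' + cnj p * y') - u' * (p * x + cnj p * y))"
    unfolding eqs by (simp add: algebra_simps)
  also have "\<dots> = x * y' - y * x'" by (simp add: ueq mult.commute)
  finally show "\<alpha> n * \<beta>' n - \<beta> n * \<alpha>' n =
      \<alpha> (n - 1) * \<beta>' (n - 1) - \<beta> (n - 1) * \<alpha>' (n - 1)"
    by (simp add: x_def y_def x'_def y'_def)
qed

lemma flow_lincomb:
  assumes "flow z \<alpha> \<beta>" "flow z \<alpha>' \<beta>'"
  shows "flow z (\<lambda>n. p * \<alpha> n + q * \<alpha>' n) (\<lambda>n. p * \<beta> n + q * \<beta>' n)"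
  unfolding flow_def
proof (intro allI conjI)
  fix n
  show "p * \<alpha> n + q * \<alpha>' n = p * \<alpha> (n - 1) + q * \<alpha>' (n - 1) + \<i> * z / of_real w * cnj (\<psi> n) *
      (\<psi> n * (p * \<alpha> (n - 1) + q * \<alpha>' (n - 1)) + cnj (\<psi> n) * (p * \<beta> (n - 1) + q * \<beta>' (n - 1)))"
    unfolding flow_step(1)[OF assms(1), of n] flow_step(1)[OF assms(2), of n]
      synth_prev[OF assms(1), of n] synth_prev[OF assms(2), of n] by (simp add: algebra_simps)
  show "p * \<beta> n + q * \<beta>' n = p * \<beta> (n - 1) + q * \<beta>' (n - 1) - \<i> * z / of_real w * \<psi> n *
      (\<psi> n * (p * \<alpha> (n - 1) + q * \<alpha>' (n - 1)) + cnj (\<psi> n) * (p * \<beta> (n - 1) + q * \<beta>' (n - 1)))"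
    unfolding flow_step(2)[OF assms(1), of n] flow_step(2)[OF assms(2), of n]
      synth_prev[OF assms(1), of n] synth_prev[OF assms(2), of n] by (simp add: algebra_simps)
qed

text \<open>Complex conjugation of a solution at a conjugated energy exchanges the two
  coefficients, since it exchanges \<open>\<psi>\<close> and \<open>cnj \<circ>
  \<psi>\<close>.\<close>

lemma flow_cnj:
  assumes "flow (cnj z) \<alpha> \<beta>"
  shows "flow z (\<lambda>n. cnj (\<beta> n)) (\<lambda>n. cnj (\<alpha> n))"
  unfolding flow_def
proof (intro allI conjI)
  fix n
  show "cnj (\<beta> n) = cnj (\<beta> (n - 1)) + \<i> * z / of_real w * cnj (\<psi> n) *
      (\<psi> n * cnj (\<beta> (n - 1)) + cnj (\<psi> n) * cnj (\<alpha> (n - 1)))"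
    unfolding flow_step(2)[OF assms, of n] synth_prev[OF assms, of n] by (simp add: algebra_simps)
  show "cnj (\<alpha> n) = cnj (\<alpha> (n - 1)) - \<i> * z / of_real w * \<psi> n *
      (\<psi> n * cnj (\<beta> (n - 1)) + cnj (\<psi> n) * cnj (\<alpha> (n - 1)))"
    unfolding flow_step(1)[OF assms, of n] synth_prev[OF assms, of n] by (simp add: algebra_simps)
qed

text \<open>One step of the flow. It is \<open>1\<close> plus a matrix of square zero that is
  linear in \<open>z\<close>, so that the inverse step is the step for \<open>-z\<close>; this runs
  the flow to the left of the origin.\<close>

fun step :: "complex \<Rightarrow> int \<Rightarrow> complex \<times> complex \<Rightarrow> complex \<times> complex" where
  "step z n (x, y) = (x + \<i> * z / of_real w * cnj (\<psi> n) * (\<psi> n * x + cnj (\<psi> n) * y),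
                      y - \<i> * z / of_real w * \<psi> n * (\<psi> n * x + cnj (\<psi> n) * y))"

lemma step_inverse: "step z n (step (- z) n v) = v"
proof (cases v)
  case (Pair x y)
  define \<kappa> u where "\<kappa> = \<i> * z / of_real w" and "u = \<psi> n * x + cnj (\<psi> n) * y"
  have s1: "step (- z) n v = (x - \<kappa> * cnj (\<psi> n) * u, y + \<kappa> * \<psi> n * u)"
    by (simp add: Pair \<kappa>_def u_def)
  have "\<psi> n * (x - \<kappa> * cnj (\<psi> n) * u) + cnj (\<psi> n) * (y + \<kappa> * \<psi> n * u) = u"
    by (simp add: u_def algebra_simps)
  then show ?thesis unfolding s1 by (simp add: Pair \<kappa>_def)
qed

primrec forward :: "complex \<Rightarrow> nat \<Rightarrow> complex \<times> complex" where
  "forward z 0 = (1, 0)"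
| "forward z (Suc m) = step z (int m + 1) (forward z m)"

primrec backward :: "complex \<Rightarrow> nat \<Rightarrow> complex \<times> complex" where
  "backward z 0 = (1, 0)"
| "backward z (Suc m) = step (- z) (- int m) (backward z m)"

definition state :: "int \<Rightarrow> complex \<Rightarrow> complex \<times> complex" where
  "state n z = (if n \<ge> 0 then forward z (nat n) else backward z (nat (- n)))"

text \<open>The flow started from \<open>(1, 0)\<close> at the origin. The flow started from
  \<open>(0, 1)\<close> has the coefficients \<open>cnj (cB n (cnj z))\<close> and \<open>cnj (cA n
  (cnj z))\<close>, so these two functions carry the whole transfer matrix.\<close>

definition cA :: "int \<Rightarrow> complex \<Rightarrow> complex" where "cA n z = fst (state n z)"
definition cB :: "int \<Rightarrow> complex \<Rightarrow> complex" where "cB n z = snd (state n z)"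

lemma state_step: "state n z = step z n (state (n - 1) z)"
proof (cases "n \<ge> 1")
  case True
  then have "nat n = Suc (nat (n - 1))" by simp
  with True show ?thesis by (simp add: state_def)
next
  case False
  have n: "state n z = backward z (nat (- n))" using False by (cases "n = 0") (simp_all add: state_def)
  have "nat (- (n - 1)) = Suc (nat (- n))" using False by simp
  then have "state (n - 1) z = step (- z) n (state n z)" using False by (simp add: state_def n[unfolded state_def])
  then show ?thesis by (simp add: step_inverse)
qed

lemma flow_cA_cB: "flow z (\<lambda>n. cA n z) (\<lambda>n. cB n z)"
  unfolding flow_def
proof (intro allI)
  fix n
  obtain x y where xy: "state (n - 1) z = (x, y)" by (cases "state (n - 1) z")
  show "cA n z = cA (n - 1) z + \<i> * z / of_real w * cnj (\<psi> n) * (\<psi> n * cA (n - 1) z + cnj (\<psi> n) * cB (n - 1) z) \<and>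
     cB n z = cB (n - 1) z - \<i> * z / of_real w * \<psi> n * (\<psi> n * cA (n - 1) z + cnj (\<psi> n) * cB (n - 1) z)"
    unfolding cA_def cB_def state_step[of n] xy by simp
qed

lemma cA_cB_base: "cA 0 z = 1" "cB 0 z = 0"
  by (simp_all add: cA_def cB_def state_def)

lemma flow_cnj_cA_cB: "flow z (\<lambda>n. cnj (cB n (cnj z))) (\<lambda>n. cnj (cA n (cnj z)))"
  by (rule flow_cnj[OF flow_cA_cB])

lemma cA_cB_det: "cA n z * cnj (cA n (cnj z)) - cB n z * cnj (cB n (cnj z)) = 1"
  using flow_det[OF flow_cA_cB[of z] flow_cnj_cA_cB[of z], of n 0] by (simp add: cA_cB_base)

lemma cA_cB_at_0: "cA n 0 = 1" "cB n 0 = 0"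
proof -
  have "cA n 0 = cA 0 0"
    by (rule int_step_constant[of "\<lambda>n. cA n 0"], subst flow_step(1)[OF flow_cA_cB]) simp
  moreover have "cB n 0 = cB 0 0"
    by (rule int_step_constant[of "\<lambda>n. cB n 0"], subst flow_step(2)[OF flow_cA_cB]) simp
  ultimately show "cA n 0 = 1" "cB n 0 = 0" by (simp_all add: cA_cB_base)
qed

lemma holomorphic_cA_cB: "cA n holomorphic_on S" "cB n holomorphic_on S"
proof -
  have stp: "(\<lambda>z. fst (step (c * z) m (v z))) holomorphic_on S \<and> (\<lambda>z. snd (step (c * z) m (v z))) holomorphic_on S"
    if "(\<lambda>z. fst (v z)) holomorphic_on S \<and> (\<lambda>z. snd (v z)) holomorphic_on S" for c m and v :: "complex \<Rightarrow> complex \<times> complex"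
  proof -
    have 1: "step (c * z) m (v z) = step (c * z) m (fst (v z), snd (v z))" for z by simp
    show ?thesis unfolding 1 step.simps fst_conv snd_conv using that w_pos
      by (intro conjI holomorphic_intros) auto
  qed
  have "(\<lambda>z. fst (forward z m)) holomorphic_on S \<and> (\<lambda>z. snd (forward z m)) holomorphic_on S" for m
    by (induction m) (use stp[of _ 1] in auto)
  moreover have "(\<lambda>z. fst (backward z m)) holomorphic_on S \<and> (\<lambda>z. snd (backward z m)) holomorphic_on S" for m
    by (induction m) (use stp[of _ "-1"] in auto)
  ultimately show "cA n holomorphic_on S" "cB n holomorphic_on S"
    unfolding atomize_conj cA_def cB_def state_def by (cases "n \<ge> 0") simp_all
qed

text \<open>Each step multiplies the sum of the moduli by at most \<open>1 + 2 \<bar>z\<bar>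
  \<bar>\<psi> n\<bar>\<^sup>2 / w\<close>. At \<open>z / cc n\<close> the bound is independent of
  \<open>n\<close>, which makes the rescaled functions a normal family.\<close>

lemma cA_cB_growth:
  assumes "n \<ge> 0"
  shows "cmod (cA n z) + cmod (cB n z) \<le> exp (2 * pi * cmod z * cc n)"
  using assms
proof (induction n rule: int_ge_induct)
  case base
  then show ?case by (simp add: cA_cB_base cc_0)
next
  case (step i)
  define p where "p = cmod (\<psi> (i + 1))"
  define h where "h = cmod z / w"
  have h: "h \<ge> 0" "p \<ge> 0" using w_pos by (simp_all add: h_def p_def)
  let ?s = "cmod (cA i z) + cmod (cB i z)"
  let ?u = "synth (\<lambda>n. cA n z) (\<lambda>n. cB n z) (i + 1)"
  have u: "cmod ?u \<le> p * ?s"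
    using synth_prev[OF flow_cA_cB[of z], of "i + 1"]
      norm_triangle_ineq[of "\<psi> (i + 1) * cA i z" "cnj (\<psi> (i + 1)) * cB i z"]
    by (simp add: norm_mult p_def distrib_left)
  have n\<kappa>: "cmod (\<i> * z / of_real w * q * ?u) \<le> h * p * (p * ?s)" if "cmod q = p" for q
  proof -
    have "cmod (\<i> * z / of_real w * q * ?u) = h * p * cmod ?u"
      using w_pos that by (simp add: norm_mult norm_divide h_def)
    also have "\<dots> \<le> h * p * (p * ?s)" using h u by (intro mult_left_mono) auto
    finally show ?thesis .
  qed
  have "cmod (cA (i + 1) z) \<le> cmod (cA i z) + h * p * (p * ?s)"
    using flow_step(1)[OF flow_cA_cB[of z], of "i + 1"] n\<kappa>[of "cnj (\<psi> (i + 1))"]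
      norm_triangle_ineq[of "cA i z" "\<i> * z / of_real w * cnj (\<psi> (i + 1)) * ?u"] by (simp add: p_def)
  moreover have "cmod (cB (i + 1) z) \<le> cmod (cB i z) + h * p * (p * ?s)"
    using flow_step(2)[OF flow_cA_cB[of z], of "i + 1"] n\<kappa>[of "\<psi> (i + 1)"]
      norm_triangle_ineq4[of "cB i z" "\<i> * z / of_real w * \<psi> (i + 1) * ?u"] by (simp add: p_def)
  ultimately have "cmod (cA (i + 1) z) + cmod (cB (i + 1) z) \<le> ?s + 2 * (h * p * (p * ?s))"
    by linarith
  also have "\<dots> = (1 + 2 * h * p\<^sup>2) * ?s" by (simp add: algebra_simps power2_eq_square)
  also have "\<dots> \<le> exp (2 * h * p\<^sup>2) * exp (2 * pi * cmod z * cc i)"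
    using step.IH exp_ge_add_one_self[of "2 * h * p\<^sup>2"] h by (intro mult_mono) auto
  also have "\<dots> = exp (2 * pi * cmod z * cc (i + 1))"
    unfolding exp_add[symmetric] cc_step[of "i + 1"] using w_pos
    by (simp add: h_def p_def field_simps)
  finally show ?case .
qed

lemma cA_deriv_0:
  assumes "n \<ge> 0"
  shows "(cA n has_field_derivative \<i> * of_real (pi * cc n)) (at 0)"
  using assms
proof (induction n rule: int_ge_induct)
  case base
  have "cA 0 = (\<lambda>_. 1)" by (simp add: fun_eq_iff cA_cB_base)
  then show ?case by (simp add: cc_0)
next
  case (step i)
  let ?p = "\<psi> (i + 1)"
  define g where "g = (\<lambda>z. \<i> / of_real w * cnj ?p * (?p * cA i z + cnj ?p * cB i z))"
  have eq: "cA (i + 1) = (\<lambda>z. cA i z + z * g z)"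
  proof
    fix z
    show "cA (i + 1) z = cA i z + z * g z"
      using flow_step(1)[OF flow_cA_cB[of z], of "i + 1"] synth_prev[OF flow_cA_cB[of z], of "i + 1"]
      by (simp add: g_def)
  qed
  have "g holomorphic_on UNIV" unfolding g_def
    by (intro holomorphic_intros holomorphic_cA_cB)
  then have "(g has_field_derivative deriv g 0) (at 0)" by (simp add: holomorphic_derivI)
  then have "((\<lambda>z. cA i z + z * g z) has_field_derivative \<i> * of_real (pi * cc i) + (1 * g 0 + deriv g 0 * 0)) (at 0)"
    by (intro DERIV_add step.IH DERIV_mult DERIV_ident)
  moreover have "g 0 = \<i> * of_real ((cmod ?p)\<^sup>2 / w)"
    by (simp add: g_def cA_cB_at_0 complex_norm_square mult_ac del: of_real_power)
  moreover have "\<i> * of_real (pi * cc i) + (1 * (\<i> * of_real ((cmod ?p)\<^sup>2 / w)) + deriv g 0 * 0) = \<i> * of_real (pi * cc (i + 1))"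
  proof -
    have "pi * cc (i + 1) = pi * cc i + (cmod ?p)\<^sup>2 / w"
      unfolding cc_step[of "i + 1"] using w_pos by (simp add: field_simps)
    then show ?thesis by (simp add: distrib_left)
  qed
  ultimately show ?case unfolding eq by simp
qed

lemma flow_energy:
  assumes fl: "flow z \<alpha> \<beta>" and "m \<le> n"
  shows "(cmod (\<alpha> n))\<^sup>2 - (cmod (\<beta> n))\<^sup>2 =
    (cmod (\<alpha> m))\<^sup>2 - (cmod (\<beta> m))\<^sup>2 - 2 * Im z / w * (\<Sum>j=m+1..n. (cmod (synth \<alpha> \<beta> j))\<^sup>2)"
  using assms(2)
proof (induction n rule: int_ge_induct)
  case (step i)
  then have "{m + 1..i + 1} = insert (i + 1) {m + 1..i}" by auto
  then have "(\<Sum>j=m+1..i+1. (cmod (synth \<alpha> \<beta> j))\<^sup>2) =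
      (cmod (synth \<alpha> \<beta> (i+1)))\<^sup>2 + (\<Sum>j=m+1..i. (cmod (synth \<alpha> \<beta> j))\<^sup>2)"
    by (simp only: sum.insert finite_atLeastAtMost_int) auto
  with step show ?case using flow_energy_step[OF fl, of "i + 1"] by (simp add: algebra_simps)
qed simp

lemma cA_cB_lower_half_plane:
  assumes "n \<ge> 0" "Im z \<le> 0"
  shows "(cmod (cA n z))\<^sup>2 \<ge> 1 + (cmod (cB n z))\<^sup>2"
proof -
  have "2 * Im z / w * (\<Sum>j=0+1..n. (cmod (synth (\<lambda>n. cA n z) (\<lambda>n. cB n z) j))\<^sup>2) \<le> 0"
    using assms w_pos by (intro mult_nonpos_nonneg sum_nonneg) (auto simp: divide_nonpos_pos)
  with flow_energy[OF flow_cA_cB[of z] assms(1)] show ?thesis by (simp add: cA_cB_base)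
qed

end


section \<open>The Weyl function\<close>

lemma square_summable_lincomb:
  fixes f g :: "'i \<Rightarrow> complex"
  assumes "(\<lambda>n. (cmod (f n))\<^sup>2) summable_on A" "(\<lambda>n. (cmod (g n))\<^sup>2) summable_on A"
  shows "(\<lambda>n. (cmod (p * f n + q * g n))\<^sup>2) summable_on A"
proof (rule summable_on_comparison_test)
  show "(\<lambda>n. 2 * (cmod p)\<^sup>2 * (cmod (f n))\<^sup>2 + 2 * (cmod q)\<^sup>2 * (cmod (g n))\<^sup>2) summable_on A"
    by (intro summable_on_add summable_on_cmult_right assms)
  fix n
  have "cmod (p * f n + q * g n) \<le> cmod p * cmod (f n) + cmod q * cmod (g n)"
    using norm_triangle_ineq[of "p * f n" "q * g n"] by (simp add: norm_mult)
  then have "(cmod (p * f n + q * g n))\<^sup>2 \<le> (cmod p * cmod (f n) + cmod q * cmod (g n))\<^sup>2"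
    by (rule power_mono) simp
  also have "\<dots> \<le> 2 * (cmod p)\<^sup>2 * (cmod (f n))\<^sup>2 + 2 * (cmod q)\<^sup>2 * (cmod (g n))\<^sup>2"
    using sum_squares_bound[of "cmod p * cmod (f n)" "cmod q * cmod (g n)"]
    by (simp add: power2_sum power_mult_distrib)
  finally show "(cmod (p * f n + q * g n))\<^sup>2 \<le> 2 * (cmod p)\<^sup>2 * (cmod (f n))\<^sup>2 + 2 * (cmod q)\<^sup>2 * (cmod (g n))\<^sup>2" .
qed simp

lemma limit_point_quadratic_form_real:
  assumes "limit_point_both a b" "v \<in> jacobi_dom UNIV a b"
  shows "Im (ell2_inner v (jacobi_on UNIV a b v)) = 0"
proof -
  let ?T = "jacobi_on UNIV a b"
  have "(v, ?T v) \<in> op_graph (jacobi_dom UNIV a b) ?T" using assms(2) by (auto simp: op_graph_def)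
  then have "(v, ?T v) \<in> adjoint_graph UNIV (jacobi_dom UNIV a b) ?T"
    using assms(1) by (simp add: limit_point_both_def self_adjoint_def)
  then have "ell2_inner v (?T v) = ell2_inner (?T v) v" using assms(2) by (simp add: adjoint_graph_def)
  also have "\<dots> = cnj (ell2_inner v (?T v))"
    by (simp add: ell2_inner_def mult.commute flip: infsum_cnj)
  finally show ?thesis by (simp add: complex_eq_iff)
qed

text \<open>The quadratic form of the whole-line operator is evaluated on the solution cut off to
  the positive half-line. It is real, and only the cut at the origin contributes besides \<open>E
  S\<close>.\<close>

lemma limit_point_half_line_identity:
  fixes u :: "int \<Rightarrow> complex"
  assumes lp: "limit_point_both a b"
    and sol: "\<And>n. n \<ge> 1 \<Longrightarrow> jacobi a b u n = E * u n"
    and sm: "((\<lambda>n. (cmod (u n))\<^sup>2) has_sum S) {1..}"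
  shows "Im E * S = Im (of_real (a 0) * cnj (u 1) * u 0)"
proof -
  define v where "v = (\<lambda>n. if n \<ge> 1 then u n else 0)"
  define d where "d = (\<lambda>n::int. if n = 1 then - of_real (a 0) * u 0 else if n = 0 then of_real (a 0) * u 1 else 0)"
  have Tv: "jacobi_on UNIV a b v n = E * v n + 1 * d n" for n
  proof -
    consider "n \<ge> 2" | "n = 1" | "n = 0" | "n < 0" by linarith
    then show ?thesis
    proof cases
      case 1
      then show ?thesis using sol[of n] by (simp add: jacobi_on_def jacobi_def v_def d_def)
    next
      case 2
      then show ?thesis using sol[of 1] by (simp add: jacobi_on_def jacobi_def v_def d_def algebra_simps)
    qed (simp_all add: jacobi_on_def jacobi_def v_def d_def)
  qed
  have hs: "((\<lambda>n. (cmod (v n))\<^sup>2) has_sum S) UNIV"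
    using sm by (subst has_sum_cong_neutral[of "{1..}" UNIV]) (auto simp: v_def)
  then have sv: "(\<lambda>n. (cmod (v n))\<^sup>2) summable_on UNIV" by (auto simp: summable_on_def)
  have "finite {n \<in> UNIV. (cmod (d n))\<^sup>2 \<noteq> 0}"
    by (rule finite_subset[of _ "{0, 1}"]) (auto simp: d_def)
  then have sd: "(\<lambda>n. (cmod (d n))\<^sup>2) summable_on UNIV" by (rule finite_nonzero_values_imp_summable_on)
  have dom: "v \<in> jacobi_dom UNIV a b"
    using sv square_summable_lincomb[OF sv sd, of E 1] by (simp add: jacobi_dom_def ell2_def Tv)
  have "((\<lambda>n. E * of_real ((cmod (v n))\<^sup>2)) has_sum (E * of_real S)) UNIV"
    by (intro has_sum_cmult_right has_sum_of_real hs)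
  moreover have "((\<lambda>n. cnj (v n) * d n) has_sum (cnj (u 1) * (- of_real (a 0) * u 0))) UNIV"
    by (rule has_sum_finite_neutralI[of "{1}"]) (auto simp: v_def d_def)
  ultimately have "((\<lambda>n. E * of_real ((cmod (v n))\<^sup>2) + cnj (v n) * d n) has_sum
      (E * of_real S + cnj (u 1) * (- of_real (a 0) * u 0))) UNIV"
    by (rule has_sum_add)
  moreover have "E * of_real ((cmod (v n))\<^sup>2) + cnj (v n) * d n = cnj (v n) * jacobi_on UNIV a b v n" for n
    by (simp add: Tv complex_norm_square algebra_simps del: of_real_power)
  ultimately have "ell2_inner v (jacobi_on UNIV a b v) = E * of_real S + cnj (u 1) * (- of_real (a 0) * u 0)"
    unfolding ell2_inner_def by (simp add: infsumI)
  with limit_point_quadratic_form_real[OF lp dom] show ?thesis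
    by (simp add: algebra_simps)
qed

lemma limit_point_half_line_unique:
  fixes u :: "int \<Rightarrow> complex"
  assumes lp: "limit_point_both a b" and E: "Im E > 0"
    and sol: "\<And>n. n \<ge> 1 \<Longrightarrow> jacobi a b u n = E * u n"
    and sm: "(\<lambda>n. (cmod (u n))\<^sup>2) summable_on {1..}" and u0: "u 0 = 0" and n: "n \<ge> 1"
  shows "u n = 0"
proof -
  from sm obtain S where S: "((\<lambda>n. (cmod (u n))\<^sup>2) has_sum S) {1..}" by (auto simp: summable_on_def)
  have "S = 0" using limit_point_half_line_identity[OF lp sol S] E u0 by simp
  then have "(cmod (u n))\<^sup>2 = 0" using nonneg_has_sum_le_0D[OF S, of n] n by simp
  then show ?thesis by simp
qed

lemma summable_on_int_half_line:
  fixes f :: "int \<Rightarrow> real"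
  assumes "\<And>j. f j \<ge> 0" "\<And>n. (\<Sum>j=1..n. f j) \<le> M"
  shows "f summable_on {1..}"
proof (rule nonneg_bdd_above_summable_on)
  show "bdd_above (sum f ` {F. F \<subseteq> {1..} \<and> finite F})"
  proof (rule bdd_aboveI2)
    fix F :: "int set" assume F: "F \<in> {F. F \<subseteq> {1..} \<and> finite F}"
    have "sum f F \<le> sum f {1..Max (insert 1 F)}"
      by (rule sum_mono2) (use F assms in auto)
    also have "\<dots> \<le> M" by (rule assms)
    finally show "sum f F \<le> M" .
  qed
qed (use assms in auto)

text \<open>The multiple of the solution that solves the resolvent equation with right-hand side
  \<open>delta 1\<close> is the one with \<open>a 0 * u 0 = -1\<close>, and no other
  square-summable sequence does.\<close>

lemma m_plus_of_solution:
  fixes u :: "int \<Rightarrow> complex"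
  assumes lp: "limit_point_both a b" and E: "Im E > 0" and a0: "a 0 > 0"
    and sol: "\<And>n. n \<ge> 1 \<Longrightarrow> jacobi a b u n = E * u n"
    and sm: "(\<lambda>n. (cmod (u n))\<^sup>2) summable_on {1..}" and u0: "u 0 \<noteq> 0"
  shows "m_plus a b E = - u 1 / (of_real (a 0) * u 0)"
proof -
  define c where "c = - 1 / (of_real (a 0) * u 0)"
  define v where "v = (\<lambda>n. if n \<ge> 1 then c * u n else 0)"
  let ?R = "\<lambda>u n. jacobi_on {1..} a b u n - E * u n"
  have Rv: "?R v = delta 1"
  proof
    fix n :: int
    consider "n \<ge> 2" | "n = 1" | "n \<le> 0" by linarith
    then show "?R v n = delta 1 n"
    proof cases
      case 1
      have "jacobi_on {1..} a b v n = c * jacobi a b u n"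
        using 1 by (simp add: jacobi_on_def jacobi_def v_def algebra_simps)
      then show ?thesis using 1 sol[of n] by (simp add: v_def delta_def)
    next
      case 2
      have "jacobi_on {1..} a b v 1 = c * (jacobi a b u 1 - of_real (a 0) * u 0)"
        by (simp add: jacobi_on_def jacobi_def v_def algebra_simps)
      also have "\<dots> = E * v 1 + 1" using sol[of 1] u0 a0 by (simp add: v_def c_def field_simps)
      finally show ?thesis using 2 by (simp add: delta_def)
    qed (simp add: jacobi_on_def v_def delta_def)
  qed
  have "(\<lambda>n. (cmod (c * u n + 0 * u n))\<^sup>2) summable_on {1..}" by (rule square_summable_lincomb[OF sm sm])
  then have sv: "(\<lambda>n. (cmod (v n))\<^sup>2) summable_on UNIV"
    by (subst summable_on_cong_neutral[of "{1..}" UNIV]) (auto simp: v_def)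
  have sdelta: "(\<lambda>n. (cmod (delta 1 n))\<^sup>2) summable_on UNIV"
    by (rule finite_nonzero_values_imp_summable_on, rule finite_subset[of _ "{1}"]) (auto simp: delta_def)
  have vdom: "v \<in> jacobi_dom {1..} a b"
  proof -
    have "jacobi_on {1..} a b v n = E * v n + 1 * delta 1 n" for n
      using fun_cong[OF Rv, of n] by (simp add: algebra_simps)
    then have "(\<lambda>n. (cmod (jacobi_on {1..} a b v n))\<^sup>2) summable_on UNIV"
      using square_summable_lincomb[OF sv sdelta, of E 1] by simp
    with sv show ?thesis
      unfolding jacobi_dom_def ell2_def by (simp add: v_def jacobi_on_def)
  qed
  have "the_inv_into (jacobi_dom {1..} a b) ?R (delta 1) = v"
    unfolding the_inv_into_def
  proof (rule the_equality)
    show "v \<in> jacobi_dom {1..} a b \<and> ?R v = delta 1" using vdom Rv by blast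
    fix v' assume v': "v' \<in> jacobi_dom {1..} a b \<and> ?R v' = delta 1"
    define d where "d = (\<lambda>n. 1 * v' n + (-1) * v n)"
    have out: "v n = 0" "v' n = 0" if "n < 1" for n
      using v' that by (auto simp: v_def jacobi_dom_def ell2_def)
    have "(\<lambda>n. (cmod (d n))\<^sup>2) summable_on UNIV"
      unfolding d_def by (rule square_summable_lincomb) (use sv v' in \<open>auto simp: jacobi_dom_def ell2_def\<close>)
    then have sd: "(\<lambda>n. (cmod (d n))\<^sup>2) summable_on {1..}" by (rule summable_on_subset_banach) simp
    have "jacobi a b d n = E * d n" if "n \<ge> 1" for n
    proof -
      have "?R v' n = ?R v n" using v' Rv by metis
      then have "jacobi a b v' n - E * v' n = jacobi a b v n - E * v n"
        using that by (simp add: jacobi_on_def)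
      moreover have "jacobi a b d n = jacobi a b v' n - jacobi a b v n"
        by (simp add: d_def jacobi_def algebra_simps)
      moreover have "d n = v' n - v n" by (simp add: d_def)
      ultimately show ?thesis by (simp only:) (simp add: algebra_simps)
    qed
    then have "d n = 0" if "n \<ge> 1" for n
      using limit_point_half_line_unique[OF lp E _ sd] out that by (simp add: d_def)
    then show "v' = v" using out by (intro ext) (metis (no_types, opaque_lifting) d_def add.inverse_inverse
        add_eq_0_iff mult_1 mult_minus1 linorder_not_less)
  qed
  then have "m_plus a b E = ell2_inner (delta 1) v" by (simp add: m_plus_def)
  also have "\<dots> = v 1"
    unfolding ell2_inner_def
    by (rule infsumI, rule has_sum_finite_neutralI[of "{1}"]) (auto simp: delta_def)
  finally show ?thesis by (simp add: v_def c_def)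
qed

lemma holomorphic_cnj_cnj:
  assumes "f holomorphic_on UNIV"
  shows "(\<lambda>z. cnj (f (cnj z))) holomorphic_on S"
proof -
  have "cnj \<circ> f \<circ> cnj holomorphic_on UNIV"
    by (rule holomorphic_on_compose_cnj_cnj) (auto intro: holomorphic_on_subset[OF assms])
  then show ?thesis by (auto simp: o_def intro: holomorphic_on_subset)
qed

context jacobi_solution
begin

lemma w_eq_boundary: "w = 2 * Im (of_real (a 0) * cnj (\<psi> 1) * \<psi> 0)"
  by (simp add: w_def wronskian_def algebra_simps)

text \<open>If \<open>\<psi>\<close> were square-summable at \<open>+\<infinity>\<close>, the
  half-line identity at the real energy \<open>\<xi>\<close> would force the Wronskian of
  \<open>cnj \<circ> \<psi>\<close> and \<open>\<psi>\<close> to vanish.\<close>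

lemma cc_at_top:
  assumes lp: "limit_point_both a b"
  shows "filterlim cc at_top at_top"
proof -
  have "\<exists>n. M < cc n" for M
  proof (rule ccontr)
    assume "\<nexists>n. M < cc n"
    then have le: "cc n \<le> M" for n by (simp add: not_less)
    have "(\<lambda>j. (cmod (\<psi> j))\<^sup>2) summable_on {1..}"
    proof (rule summable_on_int_half_line)
      fix n :: int
      show "(\<Sum>j=1..n. (cmod (\<psi> j))\<^sup>2) \<le> \<bar>M\<bar> * (pi * w)"
      proof (cases "n \<ge> 0")
        case True
        have "(\<Sum>j=1..n. (cmod (\<psi> j))\<^sup>2) = cc n * (pi * w)"
          using scale_c_sum[OF True] w_pos by (simp add: cc_def)
        also have "\<dots> \<le> \<bar>M\<bar> * (pi * w)"
          using le[of n] w_pos by (intro mult_right_mono) auto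
        finally show ?thesis .
      qed (use w_pos in simp)
    qed simp
    then obtain S where S: "((\<lambda>j. (cmod (\<psi> j))\<^sup>2) has_sum S) {1..}" by (auto simp: summable_on_def)
    have "Im (of_real \<xi>) * S = Im (of_real (a 0) * cnj (\<psi> 1) * \<psi> 0)"
      by (rule limit_point_half_line_identity[OF lp psi_solution S])
    then have "Im (of_real (a 0) * cnj (\<psi> 1) * \<psi> 0) = 0"
      by (simp only: Im_complex_of_real mult_zero_left)
    then have "w = 0" using w_eq_boundary by (simp only: mult_zero_right)
    then show False using w_pos by simp
  qed
  then show ?thesis
    unfolding filterlim_at_top eventually_at_top_linorder
    using cc_mono by (meson less_imp_le order_trans)
qed

abbreviation cA' :: "int \<Rightarrow> complex \<Rightarrow> complex" where "cA' n z \<equiv> cnj (cA n (cnj z))"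
abbreviation cB' :: "int \<Rightarrow> complex \<Rightarrow> complex" where "cB' n z \<equiv> cnj (cB n (cnj z))"

lemma flow_combination:
  "flow z (\<lambda>n. cA n z + s * cB' n z) (\<lambda>n. cB n z + s * cA' n z)"
  using flow_lincomb[OF flow_cA_cB[of z] flow_cnj_cA_cB[of z], of 1 s] by simp

lemma cA'_cB'_upper_half_plane:
  assumes "n \<ge> 0" "Im z \<ge> 0"
  shows "(cmod (cA' n z))\<^sup>2 \<ge> 1 + (cmod (cB' n z))\<^sup>2"
  using cA_cB_lower_half_plane[OF assms(1), of "cnj z"] assms(2) by simp

lemma cA'_nonzero:
  assumes "n \<ge> 0" "Im z \<ge> 0" shows "cA' n z \<noteq> 0"
proof -
  have "(cmod (cA' n z))\<^sup>2 > 0"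
    using cA'_cB'_upper_half_plane[OF assms] zero_le_power2[of "cmod (cB' n z)"] by linarith
  then show ?thesis by auto
qed

text \<open>The boundary condition \<open>\<beta> N = 0\<close> makes the Wronskian form
  nonnegative at \<open>N\<close>, hence at all earlier sites by the energy identity.\<close>

lemma weyl_approximant:
  fixes N :: int and z :: complex
  assumes N: "N \<ge> 0" and z: "Im z > 0" and n: "0 \<le> n" "n \<le> N"
  defines "s \<equiv> - cB N z / cA' N z"
  shows "cmod (cB n z + s * cA' n z) \<le> cmod (cA n z + s * cB' n z)"
proof -
  let ?\<alpha> = "\<lambda>n. cA n z + s * cB' n z" and ?\<beta> = "\<lambda>n. cB n z + s * cA' n z"
  have "(cmod (?\<beta> N))\<^sup>2 = 0" using cA'_nonzero[OF N, of z] z by (simp add: s_def)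
  moreover have "2 * Im z / w * (\<Sum>j=n+1..N. (cmod (synth ?\<alpha> ?\<beta> j))\<^sup>2) \<ge> 0"
    using z w_pos by (intro mult_nonneg_nonneg sum_nonneg) auto
  moreover have "(cmod (?\<alpha> N))\<^sup>2 - (cmod (?\<beta> N))\<^sup>2 =
    (cmod (?\<alpha> n))\<^sup>2 - (cmod (?\<beta> n))\<^sup>2 - 2 * Im z / w * (\<Sum>j=n+1..N. (cmod (synth ?\<alpha> ?\<beta> j))\<^sup>2)"
    by (rule flow_energy[OF flow_combination n(2)])
  ultimately have "(cmod (?\<beta> n))\<^sup>2 \<le> (cmod (?\<alpha> n))\<^sup>2"
    using zero_le_power2[of "cmod (?\<alpha> N)"] by linarith
  then show ?thesis by (rule power2_le_imp_le) simp
qed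

text \<open>Nonnegativity of the Wronskian form at all sites bounds the
  \<open>\<ell>\<^sup>2\<close> norm of the solution \<open>(1, s)\<close> by the energy identity,
  so this is the Weyl solution.\<close>

lemma weyl_solution_m_plus:
  assumes lp: "limit_point_both a b" and z: "Im z > 0"
    and weyl: "\<And>n. n \<ge> 0 \<Longrightarrow> cmod (cB n z + s * cA' n z) \<le> cmod (cA n z + s * cB' n z)"
  shows "\<psi> 0 + cnj (\<psi> 0) * s \<noteq> 0"
    and "m_plus a b (of_real \<xi> + z) =
      - (\<psi> 1 + cnj (\<psi> 1) * s) / (of_real (a 0) * (\<psi> 0 + cnj (\<psi> 0) * s))"
proof -
  let ?\<alpha> = "\<lambda>n. cA n z + s * cB' n z" and ?\<beta> = "\<lambda>n. cB n z + s * cA' n z"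
  define u where "u = synth ?\<alpha> ?\<beta>"
  note fl = flow_combination[of z s]
  have E: "Im (of_real \<xi> + z) > 0" using z by simp
  have sol: "jacobi a b u n = (of_real \<xi> + z) * u n" for n
    unfolding u_def by (rule jacobi_synth[OF fl])
  have u0: "u 0 = \<psi> 0 + cnj (\<psi> 0) * s" by (simp add: u_def synth_def cA_cB_base)
  have u1: "u 1 = \<psi> 1 + cnj (\<psi> 1) * s"
    using synth_prev[OF fl, of 1] by (simp add: u_def cA_cB_base)
  have sm: "(\<lambda>n. (cmod (u n))\<^sup>2) summable_on {1..}"
  proof (rule summable_on_int_half_line)
    fix n :: int
    show "(\<Sum>j=1..n. (cmod (u j))\<^sup>2) \<le> w / (2 * Im z)"
    proof (cases "n \<ge> 0")
      case True
      have "(cmod (?\<alpha> n))\<^sup>2 - (cmod (?\<beta> n))\<^sup>2 =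
        (cmod (?\<alpha> 0))\<^sup>2 - (cmod (?\<beta> 0))\<^sup>2 - 2 * Im z / w * (\<Sum>j=0+1..n. (cmod (u j))\<^sup>2)"
        unfolding u_def by (rule flow_energy[OF fl True])
      moreover have "(cmod (?\<beta> n))\<^sup>2 \<le> (cmod (?\<alpha> n))\<^sup>2"
        by (rule power_mono[OF weyl[OF True]]) simp
      moreover have "(cmod (?\<alpha> 0))\<^sup>2 = 1" "(cmod (?\<beta> 0))\<^sup>2 \<ge> 0" by (simp_all add: cA_cB_base)
      ultimately have "2 * Im z / w * (\<Sum>j=0+1..n. (cmod (u j))\<^sup>2) \<le> 1" by linarith
      then have "2 * Im z / w * (\<Sum>j=1..n. (cmod (u j))\<^sup>2) \<le> 1" by simp
      then show ?thesis using z w_pos by (simp add: field_simps)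
    qed (use z w_pos in simp)
  qed simp
  show nz: "\<psi> 0 + cnj (\<psi> 0) * s \<noteq> 0"
  proof
    assume "\<psi> 0 + cnj (\<psi> 0) * s = 0"
    then have 0: "u 0 = 0" by (simp add: u0)
    have "u 1 = 0" using limit_point_half_line_unique[OF lp E sol sm 0] by simp
    then have "cnj (\<psi> 0) * (\<psi> 1 + cnj (\<psi> 1) * s) - cnj (\<psi> 1) * (\<psi> 0 + cnj (\<psi> 0) * s) = 0"
      using 0 by (simp add: u0 u1)
    then have "wronskian a (\<lambda>m. cnj (\<psi> m)) \<psi> 0 = 0"
      by (simp add: wronskian_def algebra_simps)
    then show False using wronskian_psi[of 0] w_pos by simp
  qed
  show "m_plus a b (of_real \<xi> + z) =
      - (\<psi> 1 + cnj (\<psi> 1) * s) / (of_real (a 0) * (\<psi> 0 + cnj (\<psi> 0) * s))"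
    using m_plus_of_solution[OF lp E a_pos sol sm] nz by (simp add: u0 u1)
qed

text \<open>The reflection coefficient \<open>s\<close> of the Weyl solution, as a holomorphic
  function: a limit of the approximants, which are bounded by \<open>1\<close>. Obtaining it in
  this way gives holomorphy without studying the resolvent.\<close>

lemma weyl_function:
  obtains s where "s holomorphic_on {z. Im z > 0}"
    and "\<And>z. Im z > 0 \<Longrightarrow> cmod (s z) \<le> 1"
    and "\<And>z n. Im z > 0 \<Longrightarrow> n \<ge> 0 \<Longrightarrow>
      cmod (cB n z + s z * cA' n z) \<le> cmod (cA n z + s z * cB' n z)"
proof -
  let ?H = "{z. Im z > 0}"
  define F where "F = (\<lambda>(N::nat) z. - cB (int N) z / cA' (int N) z)"
  define \<H> where "\<H> = {h. h holomorphic_on ?H \<and> (\<forall>z\<in>?H. cmod (h z) \<le> 1)}"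
  have F_ineq: "cmod (cB n z + F N z * cA' n z) \<le> cmod (cA n z + F N z * cB' n z)"
    if "Im z > 0" "0 \<le> n" "n \<le> int N" for N n z
    unfolding F_def using weyl_approximant[of "int N" z n] that by simp
  have F_le: "cmod (F N z) \<le> 1" if "Im z > 0" for N z
    using F_ineq[OF that, of 0 N] by (simp add: cA_cB_base)
  have F: "F N \<in> \<H>" for N
    unfolding \<H>_def
  proof (intro CollectI conjI ballI)
    show "F N holomorphic_on ?H"
      unfolding F_def
      by (intro holomorphic_intros holomorphic_cA_cB holomorphic_cnj_cnj)
        (use cA'_nonzero in auto)
  qed (use F_le in auto)
  obtain s r where s: "s holomorphic_on ?H" and r: "strict_mono (r :: nat \<Rightarrow> nat)"
    and lim: "\<And>z. z \<in> ?H \<Longrightarrow> (\<lambda>N. F (r N) z) \<longlonglongrightarrow> s z"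
  proof (rule Montel[of ?H \<H> F])
    show "\<exists>B. \<forall>h\<in>\<H>. \<forall>z\<in>K. cmod (h z) \<le> B" if "compact K" "K \<subseteq> ?H" for K
      by (rule exI[of _ 1]) (use that in \<open>auto simp: \<H>_def\<close>)
  qed (use F in \<open>auto simp: \<H>_def open_halfspace_Im_gt\<close>)
  show ?thesis
  proof (rule that[OF s])
    fix z assume z: "Im z > 0"
    show "cmod (s z) \<le> 1"
      by (rule tendsto_upperbound[OF tendsto_norm[OF lim]]) (use z F_le in auto)
    fix n :: int assume n: "n \<ge> 0"
    show "cmod (cB n z + s z * cA' n z) \<le> cmod (cA n z + s z * cB' n z)"
    proof (rule tendsto_le[OF sequentially_bot])
      show "(\<lambda>N. cmod (cB n z + F (r N) z * cA' n z)) \<longlonglongrightarrow> cmod (cB n z + s z * cA' n z)"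
        "(\<lambda>N. cmod (cA n z + F (r N) z * cB' n z)) \<longlonglongrightarrow> cmod (cA n z + s z * cB' n z)"
        by (intro tendsto_intros lim; use z in simp)+
      show "\<forall>\<^sub>F N in sequentially. cmod (cB n z + F (r N) z * cA' n z) \<le> cmod (cA n z + F (r N) z * cB' n z)"
        using eventually_ge_at_top[of "nat n"]
      proof eventually_elim
        case (elim N)
        then have "n \<le> int (r N)" using seq_suble[OF r, of N] by linarith
        then show ?case using F_ineq[OF z n] by simp
      qed
    qed
  qed
qed

text \<open>\<open>s\<close> is a Moebius transform of \<open>m_plus\<close> that maps the boundary
  value of the hypothesis to \<open>0\<close>.\<close>

lemma weyl_function_normal_limit:
  assumes lp: "limit_point_both a b"
    and nl: "((\<lambda>y. m_plus a b (Complex \<xi> y)) \<longlongrightarrow> - \<psi> 1 / (of_real (a 0) * \<psi> 0)) (at_right 0)"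
    and s_le: "\<And>z. Im z > 0 \<Longrightarrow> cmod (s z) \<le> 1"
    and weyl: "\<And>z n. Im z > 0 \<Longrightarrow> n \<ge> 0 \<Longrightarrow>
      cmod (cB n z + s z * cA' n z) \<le> cmod (cA n z + s z * cB' n z)"
  shows "((\<lambda>y. s (Complex 0 y)) \<longlongrightarrow> 0) (at_right 0)"
proof -
  let ?\<eta> = "- \<psi> 1 / (of_real (a 0) * \<psi> 0)"
  let ?K = "2 * (a 0)\<^sup>2 * (cmod (\<psi> 0))\<^sup>2 / w"
  have bound: "cmod (s (Complex 0 y)) \<le> ?K * cmod (m_plus a b (Complex \<xi> y) - ?\<eta>)" if y: "y > 0" for y
  proof -
    define \<sigma> where "\<sigma> = s (Complex 0 y)"
    have Im: "Im (Complex 0 y) > 0" using y by simp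
    have cx: "of_real \<xi> + Complex 0 y = Complex \<xi> y" by (simp add: complex_eq_iff)
    define d where "d = \<psi> 0 + cnj (\<psi> 0) * \<sigma>"
    have d: "d \<noteq> 0"
      unfolding d_def \<sigma>_def by (rule weyl_solution_m_plus(1)[OF lp Im]) (rule weyl[OF Im])
    have m: "m_plus a b (Complex \<xi> y) = - (\<psi> 1 + cnj (\<psi> 1) * \<sigma>) / (of_real (a 0) * d)"
      unfolding d_def \<sigma>_def cx[symmetric] by (rule weyl_solution_m_plus(2)[OF lp Im]) (rule weyl[OF Im])
    have "\<sigma> * (\<i> * of_real w) = \<sigma> * wronskian a (\<lambda>m. cnj (\<psi> m)) \<psi> 0" by (simp add: wronskian_psi)
    also have "\<dots> = - (m_plus a b (Complex \<xi> y) - ?\<eta>) * (of_real (a 0))\<^sup>2 * \<psi> 0 * d"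
      unfolding m using d psi_nonzero[of 0] a_pos[of 0]
      by (simp add: wronskian_def field_simps power2_eq_square) (simp add: d_def algebra_simps)
    finally have "cmod (\<sigma> * (\<i> * of_real w)) = cmod (- (m_plus a b (Complex \<xi> y) - ?\<eta>) * (of_real (a 0))\<^sup>2 * \<psi> 0 * d)"
      by simp
    then have "cmod \<sigma> * w = cmod (m_plus a b (Complex \<xi> y) - ?\<eta>) * (a 0)\<^sup>2 * cmod (\<psi> 0) * cmod d"
      using w_pos by (simp only: norm_mult norm_minus_cancel norm_power norm_of_real norm_ii) simp
    also have "\<dots> \<le> cmod (m_plus a b (Complex \<xi> y) - ?\<eta>) * (a 0)\<^sup>2 * cmod (\<psi> 0) * (2 * cmod (\<psi> 0))"
    proof (rule mult_left_mono)
      have "cmod d \<le> cmod (\<psi> 0) + cmod (\<psi> 0) * cmod \<sigma>"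
        using norm_triangle_ineq[of "\<psi> 0" "cnj (\<psi> 0) * \<sigma>"] by (simp add: d_def norm_mult)
      also have "\<dots> \<le> cmod (\<psi> 0) + cmod (\<psi> 0) * 1"
        using s_le[OF Im] by (intro add_left_mono mult_left_mono) (auto simp: \<sigma>_def)
      finally show "cmod d \<le> 2 * cmod (\<psi> 0)" by simp
    qed simp
    finally show ?thesis using w_pos by (simp add: \<sigma>_def field_simps power2_eq_square)
  qed
  have "((\<lambda>y. ?K * cmod (m_plus a b (Complex \<xi> y) - ?\<eta>)) \<longlongrightarrow> ?K * cmod (?\<eta> - ?\<eta>)) (at_right 0)"
    by (intro tendsto_intros nl)
  then have "((\<lambda>y. ?K * cmod (m_plus a b (Complex \<xi> y) - ?\<eta>)) \<longlongrightarrow> 0) (at_right 0)" by simp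
  then show ?thesis
    by (rule Lim_null_comparison[rotated]) (use bound in \<open>auto simp: eventually_at_right_less eventually_at_filter\<close>)
qed

end


section \<open>The scaling limit of the transfer matrices\<close>

context jacobi_solution
begin

text \<open>Let \<open>f\<close>, \<open>g\<close> be locally uniform limits of the rescaled
  \<open>cA\<close>, \<open>cB\<close> along a subsequence. Then \<open>\<bar>g\<bar> \<le>
  \<bar>f\<bar>\<close> in the whole plane: below the real axis by the energy identity, above it
  because the Weyl solution \<open>(1, s)\<close> has a nonnegative Wronskian form and
  \<open>s\<close> vanishes in the limit. The determinant keeps \<open>f\<close> from vanishing, so
  \<open>g / f\<close> is constant, namely \<open>0\<close>, and \<open>f\<close> is an
  exponential, identified by its derivative at the origin.\<close>

lemma transfer_limit:
  fixes R \<epsilon> :: real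
  assumes lp: "limit_point_both a b"
    and nl: "((\<lambda>y. m_plus a b (Complex \<xi> y)) \<longlongrightarrow> - \<psi> 1 / (of_real (a 0) * \<psi> 0)) (at_right 0)"
    and \<epsilon>: "\<epsilon> > 0"
  shows "\<forall>\<^sub>F n in sequentially. \<forall>z. cmod z \<le> R \<longrightarrow>
    cmod (cA (int n) (z / of_real (cc (int n))) - exp (\<i> * of_real pi * z)) < \<epsilon> \<and>
    cmod (cB (int n) (z / of_real (cc (int n)))) < \<epsilon>"
proof (rule eventually_if_subsequences_meet)
  fix r :: "nat \<Rightarrow> nat" assume r: "strict_mono r"
  obtain s where s_hol: "s holomorphic_on {z. Im z > 0}"
    and s_le: "\<And>z. Im z > 0 \<Longrightarrow> cmod (s z) \<le> 1"
    and s_weyl: "\<And>z n. Im z > 0 \<Longrightarrow> n \<ge> 0 \<Longrightarrow>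
      cmod (cB n z + s z * cA' n z) \<le> cmod (cA n z + s z * cB' n z)"
    using weyl_function by blast
  note s_lim = weyl_function_normal_limit[OF lp nl s_le s_weyl]
  define F where "F = (\<lambda>n z. cA (int n) (z / of_real (cc (int n))))"
  define G where "G = (\<lambda>n z. cB (int n) (z / of_real (cc (int n))))"
  define \<H> where "\<H> = {h. h holomorphic_on UNIV \<and> (\<forall>z. cmod (h z) \<le> exp (2 * pi * cmod z))}"
  have cc_nonneg: "cc (int n) \<ge> 0" for n using cc_mono[of 0 "int n"] cc_0 by simp
  have FG: "F n \<in> \<H>" "G n \<in> \<H>" for n
  proof -
    have sc: "(\<lambda>z. f (z / of_real (cc (int n)))) holomorphic_on UNIV" if "f holomorphic_on UNIV" for f
      unfolding divide_inverse
      by (rule holomorphic_on_compose_gen[of "\<lambda>z. z * inverse (of_real (cc (int n)))" _ f UNIV, unfolded o_def])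
        (auto intro!: holomorphic_intros that)
    have le: "cmod (F n z) + cmod (G n z) \<le> exp (2 * pi * cmod z)" for z
    proof -
      have "cmod (F n z) + cmod (G n z) \<le> exp (2 * pi * cmod (z / of_real (cc (int n))) * cc (int n))"
        unfolding F_def G_def by (rule cA_cB_growth) simp
      also have "2 * pi * cmod (z / of_real (cc (int n))) * cc (int n) \<le> 2 * pi * cmod z"
        using cc_nonneg[of n] by (cases "cc (int n) = 0") (auto simp: norm_divide)
      finally show ?thesis by simp
    qed
    have "cmod (F n z) \<le> exp (2 * pi * cmod z)" "cmod (G n z) \<le> exp (2 * pi * cmod z)" for z
      using le[of z] norm_ge_zero[of "F n z"] norm_ge_zero[of "G n z"] by linarith+
    then show "F n \<in> \<H>" "G n \<in> \<H>"
      unfolding \<H>_def using sc[OF holomorphic_cA_cB(1)[of "int n"]] sc[OF holomorphic_cA_cB(2)[of "int n"]]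
      by (auto simp: F_def G_def)
  qed
  have \<H>_hol: "h holomorphic_on UNIV" if "h \<in> \<H>" for h using that by (simp add: \<H>_def)
  have \<H>_bd: "\<exists>B. \<forall>h\<in>\<H>. \<forall>z\<in>K. cmod (h z) \<le> B" if K: "compact K" for K
  proof -
    obtain b where b: "\<And>z. z \<in> K \<Longrightarrow> cmod z \<le> b"
      using compact_imp_bounded[OF K] unfolding bounded_iff by blast
    have "cmod (h z) \<le> exp (2 * pi * b)" if "h \<in> \<H>" "z \<in> K" for h z
    proof -
      have "cmod (h z) \<le> exp (2 * pi * cmod z)" using that by (simp add: \<H>_def)
      also have "\<dots> \<le> exp (2 * pi * b)" using b[OF that(2)] by simp
      finally show ?thesis .
    qed
    then show ?thesis by blast
  qed
  have rangeF: "range (\<lambda>m. F (h m)) \<subseteq> \<H>" and rangeG: "range (\<lambda>m. G (h m)) \<subseteq> \<H>" for h :: "nat \<Rightarrow> nat"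
    using FG by auto
  obtain f q1 where f: "f holomorphic_on UNIV" and q1: "strict_mono (q1 :: nat \<Rightarrow> nat)"
    and f_pt: "\<And>z. (\<lambda>m. F (r (q1 m)) z) \<longlonglongrightarrow> f z"
    and f_un: "\<And>K. compact K \<Longrightarrow> uniform_limit K (\<lambda>m. F (r (q1 m))) f sequentially"
    using Montel[of UNIV \<H> "\<lambda>m. F (r m)", OF open_UNIV \<H>_hol \<H>_bd rangeF]
    by (auto simp: o_def)
  obtain g q2 where g: "g holomorphic_on UNIV" and q2: "strict_mono (q2 :: nat \<Rightarrow> nat)"
    and g_pt: "\<And>z. (\<lambda>m. G (r (q1 (q2 m))) z) \<longlonglongrightarrow> g z"
    and g_un: "\<And>K. compact K \<Longrightarrow> uniform_limit K (\<lambda>m. G (r (q1 (q2 m)))) g sequentially"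
    using Montel[of UNIV \<H> "\<lambda>m. G (r (q1 m))", OF open_UNIV \<H>_hol \<H>_bd rangeG]
    by (auto simp: o_def)
  (* The shift by one keeps the index positive, so that no scale is zero. *)
  define p where "p = (\<lambda>m. q1 (q2 (Suc m)))"
  define k where "k = (\<lambda>m. r (p m))"
  have q2S: "strict_mono (\<lambda>m. q2 (Suc m))" using q2 by (auto simp: strict_mono_def)
  have pm: "strict_mono p" unfolding p_def using q1 q2S by (auto simp: strict_mono_def)
  have km: "strict_mono k" unfolding k_def using r pm by (auto simp: strict_mono_def)
  have k_pos: "k m \<ge> 1" for m
  proof -
    have "q2 (Suc m) \<ge> Suc m" by (rule seq_suble[OF q2])
    moreover have "q1 (q2 (Suc m)) \<ge> q2 (Suc m)" by (rule seq_suble[OF q1])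
    moreover have "r (q1 (q2 (Suc m))) \<ge> q1 (q2 (Suc m))" by (rule seq_suble[OF r])
    ultimately show ?thesis by (simp add: k_def p_def)
  qed
  define C where "C = (\<lambda>m. cc (int (k m)))"
  have C_pos: "C m > 0" for m unfolding C_def using k_pos[of m] by (intro cc_pos) simp
  have C_top: "filterlim C at_top sequentially"
  proof -
    have "filterlim (\<lambda>m. int (k m)) at_top sequentially"
      using filterlim_compose[OF filterlim_int_sequentially filterlim_subseq[OF km]] .
    from filterlim_compose[OF cc_at_top[OF lp] this] show ?thesis by (simp add: C_def)
  qed
  define t where "t = (\<lambda>m. 1 / C m)"
  have t_pos: "t m > 0" for m using C_pos by (simp add: t_def)
  have t0: "t \<longlonglongrightarrow> 0"
    unfolding t_def using tendsto_inverse_0_at_top[OF C_top] by (simp add: inverse_eq_divide)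
  have Fk: "F (k m) z = cA (int (k m)) (of_real (t m) * z)" "G (k m) z = cB (int (k m)) (of_real (t m) * z)" for m z
    by (simp_all add: F_def G_def t_def C_def)
  have f_lim: "(\<lambda>m. cA (int (k m)) (of_real (t m) * z)) \<longlonglongrightarrow> f z" for z
    using LIMSEQ_subseq_LIMSEQ[OF f_pt[of z] q2S] unfolding Fk[symmetric] by (simp add: o_def k_def p_def)
  have g_lim: "(\<lambda>m. cB (int (k m)) (of_real (t m) * z)) \<longlonglongrightarrow> g z" for z
    using LIMSEQ_ignore_initial_segment[OF g_pt[of z], of 1] unfolding Fk[symmetric] by (simp add: k_def p_def)
  have f_lim': "(\<lambda>m. cA' (int (k m)) (of_real (t m) * z)) \<longlonglongrightarrow> cnj (f (cnj z))" for z
    using tendsto_cnj[OF f_lim[of "cnj z"]] by simp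
  have g_lim': "(\<lambda>m. cB' (int (k m)) (of_real (t m) * z)) \<longlonglongrightarrow> cnj (g (cnj z))" for z
    using tendsto_cnj[OF g_lim[of "cnj z"]] by simp
  have det: "f z * cnj (f (cnj z)) - g z * cnj (g (cnj z)) = 1" for z
  proof -
    have "(\<lambda>m. 1) \<longlonglongrightarrow> f z * cnj (f (cnj z)) - g z * cnj (g (cnj z))"
      using tendsto_diff[OF tendsto_mult[OF f_lim[of z] f_lim'[of z]] tendsto_mult[OF g_lim[of z] g_lim'[of z]]]
      by (simp only: cA_cB_det)
    then show ?thesis by (simp add: LIMSEQ_const_iff)
  qed
  have dom: "cmod (g z) \<le> cmod (f z)" for z
  proof (cases "Im z > 0")
    case True
    have s0: "(\<lambda>m. s (of_real (t m) * z)) \<longlonglongrightarrow> 0"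
      by (rule holomorphic_upper_half_plane_scaling[OF s_hol s_le s_lim t_pos t0 True])
    have 1: "(\<lambda>m. cmod (cB (int (k m)) (of_real (t m) * z) + s (of_real (t m) * z) * cA' (int (k m)) (of_real (t m) * z)))
        \<longlonglongrightarrow> cmod (g z + 0 * cnj (f (cnj z)))"
      by (intro tendsto_norm tendsto_add tendsto_mult s0 g_lim f_lim')
    have 2: "(\<lambda>m. cmod (cA (int (k m)) (of_real (t m) * z) + s (of_real (t m) * z) * cB' (int (k m)) (of_real (t m) * z)))
        \<longlonglongrightarrow> cmod (f z + 0 * cnj (g (cnj z)))"
      by (intro tendsto_norm tendsto_add tendsto_mult s0 f_lim g_lim')
    have "cmod (g z + 0 * cnj (f (cnj z))) \<le> cmod (f z + 0 * cnj (g (cnj z)))"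
      by (rule tendsto_le[OF sequentially_bot 2 1], intro always_eventually allI s_weyl)
        (use True t_pos in auto)
    then show ?thesis by simp
  next
    case False
    show ?thesis
    proof (rule tendsto_le[OF sequentially_bot tendsto_norm[OF f_lim] tendsto_norm[OF g_lim]],
        intro always_eventually allI)
      fix m
      have "Im (of_real (t m) * z) \<le> 0" using False t_pos[of m] by (simp add: mult_nonneg_nonpos)
      then have "1 + (cmod (cB (int (k m)) (of_real (t m) * z)))\<^sup>2 \<le> (cmod (cA (int (k m)) (of_real (t m) * z)))\<^sup>2"
        by (rule cA_cB_lower_half_plane[rotated]) simp
      then have "(cmod (cB (int (k m)) (of_real (t m) * z)))\<^sup>2 \<le> (cmod (cA (int (k m)) (of_real (t m) * z)))\<^sup>2"
        by linarith
      then show "cmod (cB (int (k m)) (of_real (t m) * z)) \<le> cmod (cA (int (k m)) (of_real (t m) * z))"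
        by (rule power2_le_imp_le) simp
    qed
  qed
  have f_nz: "f z \<noteq> 0" for z using det[of z] dom[of z] by auto
  have f0: "f 0 = 1" using f_lim[of 0] by (simp add: cA_cB_at_0 LIMSEQ_const_iff)
  have g0: "g 0 = 0" using g_lim[of 0] by (simp add: cA_cB_at_0 LIMSEQ_const_iff)
  have g_zero: "g z = 0" for z
    by (rule entire_dominated_quotient_constant[OF g f f_nz dom g0])
  have f_growth: "cmod (f z) \<le> exp (2 * pi * cmod z)" for z
    by (rule tendsto_upperbound[OF tendsto_norm[OF f_pt]]) (use FG in \<open>auto simp: \<H>_def\<close>)
  have f_deriv: "deriv f 0 = \<i> * of_real pi"
  proof -
    have Fd: "(F (k m) has_field_derivative deriv (F (k m)) z) (at z)" for m z
      by (rule holomorphic_derivI[OF \<H>_hol[OF FG(1)] open_UNIV UNIV_I])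
    have Fu: "uniform_limit (cball z 1) (\<lambda>m. F (k m)) f sequentially" for z
      using filterlim_compose[OF f_un[OF compact_cball, of z 1] filterlim_subseq[OF q2S]]
      by (simp add: k_def p_def)
    have "\<exists>g'. \<forall>z\<in>UNIV. (f has_field_derivative g' z) (at z) \<and> (\<lambda>m. deriv (F (k m)) z) \<longlonglongrightarrow> g' z"
    proof (rule has_complex_derivative_uniform_sequence[OF open_UNIV Fd])
      show "\<exists>d>0. cball z d \<subseteq> UNIV \<and> uniform_limit (cball z d) (\<lambda>m. F (k m)) f sequentially" for z
        by (rule exI[of _ 1]) (use Fu in simp)
    qed
    then obtain g' where "\<forall>z\<in>UNIV. (f has_field_derivative g' z) (at z) \<and> (\<lambda>m. deriv (F (k m)) z) \<longlonglongrightarrow> g' z"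
      by (rule exE)
    from bspec[OF this UNIV_I[of 0]]
    have g': "(f has_field_derivative g' 0) (at 0)" "(\<lambda>m. deriv (F (k m)) 0) \<longlonglongrightarrow> g' 0"
      by simp_all
    have "deriv (F (k m)) 0 = \<i> * of_real pi" for m
    proof -
      have d: "(cA (int (k m)) has_field_derivative \<i> * of_real (pi * C m)) (at (of_real (t m) * 0))"
        unfolding C_def mult_zero_right by (rule cA_deriv_0) simp
      have "((\<lambda>z. cA (int (k m)) (of_real (t m) * z)) has_field_derivative
          (\<i> * of_real (pi * C m)) * (of_real (t m) * 1)) (at 0)"
        by (rule DERIV_chain2[OF d DERIV_cmult[OF DERIV_ident]])
      moreover have "F (k m) = (\<lambda>z. cA (int (k m)) (of_real (t m) * z))" using Fk by auto
      moreover have "(\<i> * of_real (pi * C m)) * (of_real (t m) * 1) = \<i> * of_real pi"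
        using C_pos[of m] by (simp add: t_def)
      ultimately show ?thesis by (simp add: DERIV_imp_deriv)
    qed
    then have "g' 0 = \<i> * of_real pi" using g'(2) by (simp add: LIMSEQ_const_iff)
    with g'(1) show ?thesis by (simp add: DERIV_imp_deriv)
  qed
  have f_exp: "f z = exp (\<i> * of_real pi * z)" for z
    using entire_exponential_type_no_zeros[OF f f_nz f0 f_growth] by (simp add: f_deriv)
  have "\<forall>\<^sub>F m in sequentially. \<forall>z\<in>cball 0 R. dist (F (r (q1 m)) z) (f z) < \<epsilon>"
    using uniform_limitD[OF f_un[OF compact_cball] \<epsilon>] .
  then have "\<forall>\<^sub>F m in sequentially. \<forall>z\<in>cball 0 R. dist (F (r (q1 (q2 m))) z) (f z) < \<epsilon>"
    by (rule eventually_compose_filterlim[OF _ filterlim_subseq[OF q2]])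
  moreover have "\<forall>\<^sub>F m in sequentially. \<forall>z\<in>cball 0 R. dist (G (r (q1 (q2 m))) z) (g z) < \<epsilon>"
    using uniform_limitD[OF g_un[OF compact_cball] \<epsilon>] .
  ultimately obtain m where m: "\<forall>z\<in>cball 0 R. dist (F (r (q1 (q2 m))) z) (f z) < \<epsilon>"
    "\<forall>z\<in>cball 0 R. dist (G (r (q1 (q2 m))) z) (g z) < \<epsilon>"
    using eventually_happens'[OF sequentially_bot eventually_conj] by blast
  show "\<exists>m. \<forall>z. cmod z \<le> R \<longrightarrow>
    cmod (cA (int (r m)) (z / of_real (cc (int (r m)))) - exp (\<i> * of_real pi * z)) < \<epsilon> \<and>
    cmod (cB (int (r m)) (z / of_real (cc (int (r m))))) < \<epsilon>"
    by (rule exI[of _ "q1 (q2 m)"]) (use m in \<open>auto simp: dist_norm f_exp g_zero F_def G_def\<close>)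
qed

text \<open>Scaling by an arbitrary large \<open>\<tau>\<close> instead of \<open>cc k\<close>,
  uniformly in \<open>k\<close>. For large \<open>k\<close> this is the scaling limit at the point
  \<open>z * cc k / \<tau>\<close>, which stays bounded. The remaining finitely many
  \<open>k\<close> need only continuity at \<open>0\<close>, as \<open>z / \<tau>\<close> and
  \<open>cc k / \<tau>\<close> tend to \<open>0\<close>.\<close>

lemma transfer_asymptotics:
  fixes R Q \<epsilon> :: real and k0 :: int
  assumes lp: "limit_point_both a b"
    and nl: "((\<lambda>y. m_plus a b (Complex \<xi> y)) \<longlongrightarrow> - \<psi> 1 / (of_real (a 0) * \<psi> 0)) (at_right 0)"
    and \<epsilon>: "\<epsilon> > 0" and R: "R > 0"
  shows "\<forall>\<^sub>F \<tau> in at_top. \<forall>k\<ge>k0. \<bar>cc k\<bar> \<le> Q * \<tau> \<longrightarrow> (\<forall>z. cmod z \<le> R \<longrightarrow>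
    cmod (cA k (z / of_real \<tau>) - exp (\<i> * of_real pi * z * of_real (cc k / \<tau>))) < \<epsilon> \<and>
    cmod (cB k (z / of_real \<tau>)) < \<epsilon>)"
proof -
  let ?P = "\<lambda>k \<tau>. \<forall>z. cmod z \<le> R \<longrightarrow>
    cmod (cA k (z / of_real \<tau>) - exp (\<i> * of_real pi * z * of_real (cc k / \<tau>))) < \<epsilon> \<and>
    cmod (cB k (z / of_real \<tau>)) < \<epsilon>"
  obtain N where N: "\<And>n z. n \<ge> N \<Longrightarrow> cmod z \<le> R * Q \<Longrightarrow>
    cmod (cA (int n) (z / of_real (cc (int n))) - exp (\<i> * of_real pi * z)) < \<epsilon> \<and>
    cmod (cB (int n) (z / of_real (cc (int n)))) < \<epsilon>"
    using transfer_limit[OF lp nl \<epsilon>, of "R * Q"] unfolding eventually_sequentially by blast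
  have large: "?P k \<tau>" if k: "k > int N" and c: "\<bar>cc k\<bar> \<le> Q * \<tau>" and \<tau>: "\<tau> > 0" for k \<tau>
  proof (intro allI impI)
    fix z :: complex assume z: "cmod z \<le> R"
    have cpos: "cc k > 0" using k by (intro cc_pos) simp
    have "cmod (z * of_real (cc k / \<tau>)) \<le> R * Q"
    proof -
      have "cc k / \<tau> \<le> Q" using c \<tau> by (simp add: divide_le_eq)
      then show ?thesis using z cpos \<tau> R unfolding norm_mult
        by (intro mult_mono) (auto simp: norm_divide)
    qed
    from N[of "nat k", OF _ this] k have "cmod (cA k (z * of_real (cc k / \<tau>) / of_real (cc k)) - exp (\<i> * of_real pi * (z * of_real (cc k / \<tau>)))) < \<epsilon> \<and>
      cmod (cB k (z * of_real (cc k / \<tau>) / of_real (cc k))) < \<epsilon>" by simp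
    moreover have "z * of_real (cc k / \<tau>) / of_real (cc k) = z / of_real \<tau>" using cpos by simp
    ultimately show "cmod (cA k (z / of_real \<tau>) - exp (\<i> * of_real pi * z * of_real (cc k / \<tau>))) < \<epsilon> \<and>
      cmod (cB k (z / of_real \<tau>)) < \<epsilon>" by (simp only: mult.assoc)
  qed
  have small: "\<forall>\<^sub>F \<tau> in at_top. ?P k \<tau>" for k
  proof -
    let ?f = "\<lambda>\<zeta>. cA k \<zeta> - exp (\<i> * of_real pi * \<zeta> * of_real (cc k))"
    have cA_c: "isCont (cA k) 0" "isCont (cB k) 0"
      using holomorphic_cA_cB[of k UNIV] by (auto dest!: holomorphic_on_imp_continuous_on simp: continuous_on_eq_continuous_at)
    then have "isCont ?f 0" by (intro continuous_intros)
    then have "?f \<midarrow>0\<rightarrow> ?f 0" "cB k \<midarrow>0\<rightarrow> cB k 0" using cA_c by (simp_all only: isCont_def)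
    then have "?f \<midarrow>0\<rightarrow> 0" "cB k \<midarrow>0\<rightarrow> 0" by (simp_all add: cA_cB_at_0)
    then obtain d1 d2 where d: "d1 > 0" "d2 > 0"
      "\<And>\<zeta>. \<zeta> \<noteq> 0 \<Longrightarrow> cmod \<zeta> < d1 \<Longrightarrow> cmod (?f \<zeta>) < \<epsilon>"
      "\<And>\<zeta>. \<zeta> \<noteq> 0 \<Longrightarrow> cmod \<zeta> < d2 \<Longrightarrow> cmod (cB k \<zeta>) < \<epsilon>"
      using \<epsilon> unfolding LIM_eq by (metis diff_zero)
    show ?thesis
      using eventually_gt_at_top[of 0] eventually_gt_at_top[of "R / d1"] eventually_gt_at_top[of "R / d2"]
    proof eventually_elim
      case (elim \<tau>)
      show ?case
      proof (intro allI impI)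
        fix z :: complex assume z: "cmod z \<le> R"
        let ?\<zeta> = "z / of_real \<tau>"
        have "R < \<tau> * d1" "R < \<tau> * d2" using elim d by (simp_all add: field_simps)
        then have "cmod ?\<zeta> < d1" "cmod ?\<zeta> < d2"
          using z elim by (simp_all add: norm_divide divide_less_eq mult.commute)
        then have "cmod (?f ?\<zeta>) < \<epsilon> \<and> cmod (cB k ?\<zeta>) < \<epsilon>"
        proof (cases "?\<zeta> = 0")
          case True
          show ?thesis unfolding True using \<epsilon> by (simp add: cA_cB_at_0)
        next
          case False
          then show ?thesis using d \<open>cmod ?\<zeta> < d1\<close> \<open>cmod ?\<zeta> < d2\<close> by blast
        qed
        then show "cmod (cA k ?\<zeta> - exp (\<i> * of_real pi * z * of_real (cc k / \<tau>))) < \<epsilon> \<and> cmod (cB k ?\<zeta>) < \<epsilon>"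
          by simp
      qed
    qed
  qed
  have "\<forall>\<^sub>F \<tau> in at_top. \<forall>k\<in>{k0..int N}. ?P k \<tau>"
    by (intro eventually_ball_finite ballI small) simp
  then show ?thesis
    using eventually_gt_at_top[of 0]
  proof eventually_elim
    case (elim \<tau>)
    show ?case
    proof (intro allI impI)
      fix k z assume *: "k0 \<le> k" "\<bar>cc k\<bar> \<le> Q * \<tau>" "cmod z \<le> R"
      show "cmod (cA k (z / of_real \<tau>) - exp (\<i> * of_real pi * z * of_real (cc k / \<tau>))) < \<epsilon> \<and>
        cmod (cB k (z / of_real \<tau>)) < \<epsilon>"
        using elim large[of k \<tau>] * by (cases "k > int N") auto
    qed
  qed
qed

end


section \<open>Eigenvalues of truncations\<close>

lemma finite_jacobi_trunc_eigenvalues: "finite {y. eigenvalue (jacobi_trunc a b k n) y}"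
  using card_finite_spectrum(1)[of "jacobi_trunc a b k n" "nat (n - k)"]
  by (simp add: jacobi_trunc_def spectrum_def)

lemma jacobi_trunc_mult_vec:
  fixes e :: "int \<Rightarrow> real"
  assumes kn: "k < n" and m: "k < m" "m \<le> n" and e: "e k = 0" "e (n + 1) = 0"
  defines "v \<equiv> vec (nat (n - k)) (\<lambda>i. e (k + 1 + int i))"
  shows "(jacobi_trunc a b k n *\<^sub>v v) $ nat (m - k - 1) = a (m - 1) * e (m - 1) + b m * e m + a m * e (m + 1)"
proof -
  let ?N = "nat (n - k)"
  define i where "i = nat (m - k - 1)"
  have iN: "i < ?N" and mi: "m = k + 1 + int i" using m by (auto simp: i_def)
  have "(jacobi_trunc a b k n *\<^sub>v v) $ i = (\<Sum>j\<in>{0..<?N}. (if i = j then b (k + 1 + int i)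
             else if j = Suc i then a (k + 1 + int i)
             else if i = Suc j then a (k + 1 + int j) else 0) * e (k + 1 + int j))"
    using iN by (simp add: jacobi_trunc_def v_def scalar_prod_def)
  also have "\<dots> = (\<Sum>j\<in>{0..<?N}. (if j = i then b m * e m else 0)
      + (if j = Suc i then a m * e (m + 1) else 0)
      + (if Suc j = i then a (m - 1) * e (m - 1) else 0))"
    by (rule sum.cong) (auto simp: mi algebra_simps)
  also have "\<dots> = (\<Sum>j\<in>{0..<?N}. if j = i then b m * e m else 0)
      + (\<Sum>j\<in>{0..<?N}. if j = Suc i then a m * e (m + 1) else 0)
      + (\<Sum>j\<in>{0..<?N}. if Suc j = i then a (m - 1) * e (m - 1) else 0)"
    by (simp only: sum.distrib)
  also have "(\<Sum>j\<in>{0..<?N}. if j = i then b m * e m else 0) = b m * e m"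
    using iN by simp
  also have "(\<Sum>j\<in>{0..<?N}. if j = Suc i then a m * e (m + 1) else 0) = a m * e (m + 1)"
  proof (cases "Suc i < ?N")
    case False
    then have "m = n" using iN mi by linarith
    then show ?thesis using False e by simp
  qed simp
  also have "(\<Sum>j\<in>{0..<?N}. if Suc j = i then a (m - 1) * e (m - 1) else 0) = a (m - 1) * e (m - 1)"
  proof (cases i)
    case 0
    then show ?thesis using mi e by simp
  next
    case (Suc i')
    then have "(\<Sum>j\<in>{0..<?N}. if Suc j = i then a (m - 1) * e (m - 1) else 0) =
      (\<Sum>j\<in>{0..<?N}. if j = i' then a (m - 1) * e (m - 1) else 0)"
      by (intro sum.cong) auto
    then show ?thesis using Suc iN by simp
  qed
  finally show ?thesis by (simp add: i_def)
qed

lemma jacobi_solution_zero: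
  fixes f :: "int \<Rightarrow> complex"
  assumes a: "\<And>i. a i > 0" and rec: "\<And>m. k < m \<Longrightarrow> m \<le> n \<Longrightarrow> jacobi a b f m = E * f m"
    and f: "f k = 0" "f (k + 1) = 0" and m: "k \<le> m" "m \<le> n"
  shows "f m = 0 \<and> f (m + 1) = 0"
  using m
proof (induction m rule: int_ge_induct)
  case (step i)
  then have 0: "f i = 0" "f (i + 1) = 0" by auto
  have "jacobi a b f (i + 1) = E * f (i + 1)" by (rule rec) (use step in auto)
  then have "of_real (a (i + 1)) * f (i + 1 + 1) = 0" using 0 by (simp add: jacobi_def)
  then show ?case using 0 a[of "i + 1"] by simp
qed (use f in simp)

text \<open>An eigenvector, extended by \<open>0\<close> to the sites \<open>k\<close> and \<open>n
  + 1\<close>, is a solution vanishing at \<open>k\<close>; such solutions are proportional to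
  \<open>u\<close>.\<close>

lemma eigenvalue_jacobi_trunc_iff:
  fixes u :: "int \<Rightarrow> complex"
  assumes a: "\<And>i. a i > 0" and kn: "k < n"
    and rec: "\<And>m. k < m \<Longrightarrow> m \<le> n \<Longrightarrow> jacobi a b u m = of_real x * u m"
    and u: "u k = 0" "u (k + 1) \<noteq> 0"
  shows "eigenvalue (jacobi_trunc a b k n) x \<longleftrightarrow> u (n + 1) = 0"
proof
  let ?T = "jacobi_trunc a b k n" and ?N = "nat (n - k)"
  have dimT: "dim_row ?T = ?N" "dim_col ?T = ?N" by (simp_all add: jacobi_trunc_def)
  {
    assume "eigenvalue ?T x"
    then obtain v where v: "v \<in> carrier_vec ?N" "v \<noteq> 0\<^sub>v ?N" "?T *\<^sub>v v = x \<cdot>\<^sub>v v"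
      unfolding eigenvalue_def eigenvector_def dimT by blast
    define e where "e = (\<lambda>m. if k < m \<and> m \<le> n then v $ nat (m - k - 1) else 0)"
    have ve: "v = vec ?N (\<lambda>i. e (k + 1 + int i))"
      using v(1) by (intro eq_vecI) (auto simp: e_def)
    have e0: "e k = 0" "e (n + 1) = 0" by (auto simp: e_def)
    have e_rec: "a (m - 1) * e (m - 1) + b m * e m + a m * e (m + 1) = x * e m" if m: "k < m" "m \<le> n" for m
    proof -
      have "a (m - 1) * e (m - 1) + b m * e m + a m * e (m + 1) = (?T *\<^sub>v v) $ nat (m - k - 1)"
        unfolding ve using jacobi_trunc_mult_vec[OF kn m e0] by simp
      also have "\<dots> = x * v $ nat (m - k - 1)" unfolding v(3) using v(1) m by simp
      also have "\<dots> = x * e m" using m by (simp add: e_def)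
      finally show ?thesis .
    qed
    (* This combination of two solutions vanishes at k and k + 1, hence everywhere. *)
    define f where "f = (\<lambda>m. u m * of_real (e (k + 1)) - of_real (e m) * u (k + 1))"
    have f_rec: "jacobi a b f m = of_real x * f m" if m: "k < m" "m \<le> n" for m
    proof -
      have "jacobi a b f m = jacobi a b u m * of_real (e (k + 1))
          - of_real (a (m - 1) * e (m - 1) + b m * e m + a m * e (m + 1)) * u (k + 1)"
        by (simp add: jacobi_def f_def algebra_simps)
      then show ?thesis unfolding rec[OF m] e_rec[OF m] by (simp add: f_def algebra_simps)
    qed
    have f0: "f m = 0 \<and> f (m + 1) = 0" if "k \<le> m" "m \<le> n" for m
      by (rule jacobi_solution_zero[OF a f_rec _ _ that]) (auto simp: f_def u e0)
    have "e (k + 1) \<noteq> 0"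
    proof
      assume 0: "e (k + 1) = 0"
      have "e m = 0" if "k < m" "m \<le> n" for m
        using f0[of m] that 0 u by (simp add: f_def)
      then have "v = 0\<^sub>v ?N" unfolding ve by (intro eq_vecI) auto
      with v show False by simp
    qed
    moreover have "f (n + 1) = 0" using f0[of n] kn by simp
    ultimately show "u (n + 1) = 0" using e0 by (simp add: f_def)
  }
  {
    assume un: "u (n + 1) = 0"
    define e where "e = (\<lambda>m. Re (u m / u (k + 1)))"
    have e0: "e k = 0" "e (n + 1) = 0" "e (k + 1) = 1" using u un by (auto simp: e_def)
    have e_rec: "a (m - 1) * e (m - 1) + b m * e m + a m * e (m + 1) = x * e m" if m: "k < m" "m \<le> n" for m
    proof -
      have "Re (jacobi a b u m / u (k + 1)) = Re (of_real x * (u m / u (k + 1)))"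
        by (simp add: rec[OF m])
      moreover have "jacobi a b u m / u (k + 1) = of_real (a (m - 1)) * (u (m - 1) / u (k + 1))
          + of_real (b m) * (u m / u (k + 1)) + of_real (a m) * (u (m + 1) / u (k + 1))"
        by (simp add: jacobi_def add_divide_distrib)
      ultimately show ?thesis by (simp only: plus_complex.simps Re_complex_of_real Im_complex_of_real times_complex.simps
          mult_zero_left diff_zero e_def)
    qed
    define v where "v = vec ?N (\<lambda>i. e (k + 1 + int i))"
    have "?T *\<^sub>v v = x \<cdot>\<^sub>v v"
    proof (rule eq_vecI)
      fix i assume "i < dim_vec (x \<cdot>\<^sub>v v)"
      then have i: "i < ?N" by (simp add: v_def)
      define m where "m = k + 1 + int i"
      have m: "k < m" "m \<le> n" "nat (m - k - 1) = i" using i by (auto simp: m_def)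
      have "(?T *\<^sub>v v) $ i = x * e m"
        using jacobi_trunc_mult_vec[OF kn m(1,2) e0(1,2), of a b] e_rec[OF m(1,2)] unfolding m(3) v_def by simp
      then show "(?T *\<^sub>v v) $ i = (x \<cdot>\<^sub>v v) $ i" using i by (simp add: v_def m_def)
    qed (simp add: v_def dimT)
    moreover have "v \<noteq> 0\<^sub>v ?N"
    proof
      assume "v = 0\<^sub>v ?N"
      then have "v $ 0 = 0" using kn by simp
      then show False using kn e0(3) by (simp add: v_def)
    qed
    ultimately show "eigenvalue ?T x"
      unfolding eigenvalue_def eigenvector_def dimT by (intro exI[of _ v]) (simp add: v_def)
  }
qed



section \<open>Eigenvalue spacing\<close>

context jacobi_solution
begin

text \<open>The entries of the first row of the transfer matrix from \<open>k\<close> to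
  \<open>n\<close>, that is, of the matrix at \<open>n\<close> times the inverse of the matrix at
  \<open>k\<close>.\<close>

definition transfer_diag :: "int \<Rightarrow> int \<Rightarrow> complex \<Rightarrow> complex" where
  "transfer_diag k n z = cA n z * cA' k z - cB' n z * cB k z"

definition transfer_off :: "int \<Rightarrow> int \<Rightarrow> complex \<Rightarrow> complex" where
  "transfer_off k n z = cB' n z * cA k z - cA n z * cB' k z"

text \<open>The solution with coefficients \<open>(cnj (\<psi> k), - \<psi> k)\<close> at
  \<open>k\<close> vanishes at \<open>k\<close>. At a real energy it is purely imaginary, and its
  value at \<open>n + 1\<close> is a multiple of the imaginary part in question.\<close>

lemma eigenvalue_iff_transfer:
  fixes x :: real
  assumes kn: "k < n"
  shows "eigenvalue (jacobi_trunc a b k n) (\<xi> + x) \<longleftrightarrow>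
    Im (\<psi> (n + 1) * (cnj (\<psi> k) * transfer_diag k n (of_real x) - \<psi> k * transfer_off k n (of_real x))) = 0"
proof -
  let ?z = "complex_of_real x"
  define p where "p = cA' k ?z * cnj (\<psi> k) + cB' k ?z * \<psi> k"
  define q where "q = - (cB k ?z * cnj (\<psi> k) + cA k ?z * \<psi> k)"
  define \<alpha> where "\<alpha> = (\<lambda>m. p * cA m ?z + q * cB' m ?z)"
  define \<beta> where "\<beta> = (\<lambda>m. p * cB m ?z + q * cA' m ?z)"
  have fl: "flow ?z \<alpha> \<beta>"
    unfolding \<alpha>_def \<beta>_def by (rule flow_lincomb[OF flow_cA_cB flow_cnj_cA_cB])
  have q: "q = - cnj p" by (simp add: p_def q_def)
  have \<beta>: "\<beta> m = - cnj (\<alpha> m)" for m by (simp add: \<alpha>_def \<beta>_def q)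
  have \<alpha>: "\<alpha> m = cnj (\<psi> k) * transfer_diag k m ?z - \<psi> k * transfer_off k m ?z" for m
    by (simp add: \<alpha>_def p_def q_def transfer_diag_def transfer_off_def algebra_simps)
  have "transfer_diag k k ?z = 1"
    using cA_cB_det[of k ?z] by (simp add: transfer_diag_def mult.commute)
  moreover have "transfer_off k k ?z = 0" by (simp add: transfer_off_def mult.commute)
  ultimately have \<alpha>k: "\<alpha> k = cnj (\<psi> k)" by (simp add: \<alpha>)
  let ?u = "synth \<alpha> \<beta>"
  have uk: "?u k = 0" by (simp add: synth_def \<alpha>k \<beta>)
  have next_val: "?u (m + 1) = 2 * \<i> * of_real (Im (\<psi> (m + 1) * \<alpha> m))" for m
    using synth_prev[OF fl, of "m + 1"] by (simp add: \<beta> complex_eq_iff)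
  have "of_real (a k) * ?u (k + 1) = - wronskian a (\<lambda>m. cnj (\<psi> m)) \<psi> k"
  proof -
    have u1: "?u (k + 1) = \<psi> (k + 1) * cnj (\<psi> k) - cnj (\<psi> (k + 1)) * \<psi> k"
      using synth_prev[OF fl, of "k + 1"] by (simp add: \<beta> \<alpha>k)
    show ?thesis unfolding wronskian_def u1 by (simp add: algebra_simps)
  qed
  then have uk1: "?u (k + 1) \<noteq> 0" using wronskian_psi[of k] w_pos by auto
  have rec: "jacobi a b ?u m = of_real (\<xi> + x) * ?u m" for m
    using jacobi_synth[OF fl, of m] by simp
  have "eigenvalue (jacobi_trunc a b k n) (\<xi> + x) \<longleftrightarrow> ?u (n + 1) = 0"
    by (rule eigenvalue_jacobi_trunc_iff[OF a_pos kn rec uk uk1])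
  also have "\<dots> \<longleftrightarrow> Im (\<psi> (n + 1) * \<alpha> n) = 0" unfolding next_val
    by (simp only: mult_eq_0_iff of_real_eq_0_iff complex_i_not_zero zero_neq_numeral[symmetric] simp_thms)
  finally show ?thesis unfolding \<alpha> .
qed

text \<open>The product of the limiting diagonal matrices is \<open>exp (\<i> * \<pi> * z * (c -
  c'))\<close> on the diagonal; this is where the normalization \<open>c - c' = 1\<close> by the
  scale of the interval enters.\<close>

lemma transfer_estimate:
  fixes c c' \<epsilon> M R \<tau> :: real
  assumes An: "\<And>z. cmod z \<le> R \<Longrightarrow>
      cmod (cA n (z / of_real \<tau>) - exp (\<i> * of_real pi * z * of_real c)) < \<epsilon> \<and> cmod (cB n (z / of_real \<tau>)) < \<epsilon>"
    and Ak: "\<And>z. cmod z \<le> R \<Longrightarrow>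
      cmod (cA k (z / of_real \<tau>) - exp (\<i> * of_real pi * z * of_real c')) < \<epsilon> \<and> cmod (cB k (z / of_real \<tau>)) < \<epsilon>"
    and c: "\<bar>c\<bar> \<le> Q" "\<bar>c'\<bar> \<le> Q" "c - c' = 1" and \<epsilon>: "\<epsilon> \<le> 1" and z: "cmod z \<le> R"
    and M: "M \<ge> 1 + exp (pi * R * Q)"
  shows "cmod (transfer_diag k n (z / of_real \<tau>) - exp (\<i> * of_real pi * z)) \<le> 3 * M * \<epsilon>"
    and "cmod (transfer_off k n (z / of_real \<tau>)) \<le> 2 * M * \<epsilon>"
proof -
  let ?\<zeta> = "z / of_real \<tau>"
  let ?e = "\<lambda>c. exp (\<i> * of_real pi * z * of_real c)"
  have z': "cmod (cnj z) \<le> R" using z by simp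
  have e_bound: "cmod (exp (\<i> * of_real pi * z * of_real d)) \<le> exp (pi * R * Q)" if "\<bar>d\<bar> \<le> Q" for d
  proof -
    have "cmod (exp (\<i> * of_real pi * z * of_real d)) \<le> exp (cmod (\<i> * of_real pi * z * of_real d))"
      by (rule norm_exp)
    also have "cmod (\<i> * of_real pi * z * of_real d) \<le> pi * R * Q"
      unfolding norm_mult using z that by (simp add: mult.assoc) (intro mult_left_mono mult_mono, auto intro: order_trans[OF norm_ge_zero])
    finally show ?thesis by simp
  qed
  have split: "cmod x \<le> M" if "cmod (x - y) < \<epsilon>" "cmod y \<le> exp (pi * R * Q)" for x y :: complex
    using norm_triangle_ineq2[of x y] that \<epsilon> M by linarith
  have an: "cmod (cA n ?\<zeta> - ?e c) < \<epsilon>" and bn: "cmod (cB n ?\<zeta>) < \<epsilon>" using An[OF z] by auto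
  have ak: "cmod (cA k ?\<zeta> - ?e c') < \<epsilon>" and bk: "cmod (cB k ?\<zeta>) < \<epsilon>" using Ak[OF z] by auto
  have ak': "cmod (cA' k ?\<zeta> - ?e (- c')) < \<epsilon>"
  proof -
    have "cA' k ?\<zeta> - ?e (- c') = cnj (cA k (cnj z / of_real \<tau>) - exp (\<i> * of_real pi * cnj z * of_real c'))"
      by (simp add: exp_cnj)
    then show ?thesis using Ak[OF z'] by (simp only: complex_mod_cnj)
  qed
  have bk': "cmod (cB' k ?\<zeta>) < \<epsilon>" and bn': "cmod (cB' n ?\<zeta>) < \<epsilon>"
    using Ak[OF z'] An[OF z'] by simp_all
  have An_M: "cmod (cA n ?\<zeta>) \<le> M" by (rule split[OF an e_bound]) (use c in auto)
  have Ak_M: "cmod (cA k ?\<zeta>) \<le> M" by (rule split[OF ak e_bound]) (use c in auto)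
  have e_M: "cmod (?e (- c')) \<le> M"
  proof -
    have "cmod (?e (- c')) \<le> exp (pi * R * Q)" by (rule e_bound) (use c in simp)
    with M show ?thesis by linarith
  qed
  have M1: "M \<ge> 1" using M by (smt (verit) exp_ge_zero)
  have prod: "cmod (x * y) \<le> M * \<epsilon>" if "cmod x \<le> M" "cmod y < \<epsilon>" for x y :: complex
    unfolding norm_mult using that M1 by (intro mult_mono) auto
  have e1: "?e c * ?e (- c') = exp (\<i> * of_real pi * z)"
  proof -
    have "?e c * ?e (- c') = exp (\<i> * of_real pi * z * of_real (c - c'))"
      by (simp add: algebra_simps flip: exp_add)
    then show ?thesis by (simp add: c)
  qed
  have "transfer_diag k n ?\<zeta> - exp (\<i> * of_real pi * z) =
      cA n ?\<zeta> * (cA' k ?\<zeta> - ?e (- c')) + ?e (- c') * (cA n ?\<zeta> - ?e c) - cB' n ?\<zeta> * cB k ?\<zeta>"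
    unfolding transfer_diag_def e1[symmetric] by (simp add: algebra_simps)
  also have "cmod \<dots> \<le> M * \<epsilon> + M * \<epsilon> + M * \<epsilon>"
    by (intro norm_triangle_le_diff norm_triangle_le add_mono prod An_M ak' e_M an bk)
      (use bn' \<epsilon> M1 in linarith)
  finally show "cmod (transfer_diag k n ?\<zeta> - exp (\<i> * of_real pi * z)) \<le> 3 * M * \<epsilon>" by simp
  have "cmod (cB' n ?\<zeta> * cA k ?\<zeta>) \<le> M * \<epsilon>" "cmod (cA n ?\<zeta> * cB' k ?\<zeta>) \<le> M * \<epsilon>"
    using prod[OF Ak_M bn'] prod[OF An_M bk'] by (simp_all add: mult.commute)
  then show "cmod (transfer_off k n ?\<zeta>) \<le> 2 * M * \<epsilon>"
    unfolding transfer_off_def using norm_triangle_ineq4[of "cB' n ?\<zeta> * cA k ?\<zeta>" "cA n ?\<zeta> * cB' k ?\<zeta>"]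
    by linarith
qed

lemma holomorphic_transfer:
  "(\<lambda>z. transfer_diag k n (z / of_real \<tau>)) holomorphic_on S"
  "(\<lambda>z. transfer_off k n (z / of_real \<tau>)) holomorphic_on S"
proof -
  have sc: "(\<lambda>z. f (z / of_real \<tau>)) holomorphic_on S" if "f holomorphic_on UNIV" for f :: "complex \<Rightarrow> complex"
    unfolding divide_inverse
    by (rule holomorphic_on_compose_gen[of "\<lambda>z. z * inverse (of_real \<tau>)" _ f UNIV, unfolded o_def])
      (auto intro!: holomorphic_intros that)
  have "transfer_diag k n holomorphic_on UNIV" "transfer_off k n holomorphic_on UNIV"
    unfolding transfer_diag_def[abs_def] transfer_off_def[abs_def]
    by (intro holomorphic_intros holomorphic_cA_cB holomorphic_cnj_cnj)+
  then show "(\<lambda>z. transfer_diag k n (z / of_real \<tau>)) holomorphic_on S"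
    "(\<lambda>z. transfer_off k n (z / of_real \<tau>)) holomorphic_on S" by (auto intro: sc)
qed

text \<open>After division by \<open>\<bar>\<psi> k\<bar> \<bar>\<psi> (n + 1)\<bar>\<close>, the
  eigenvalue condition is the vanishing of the imaginary part of a function close to \<open>e1 *
  exp (\<i> * \<pi> * z)\<close>, with a unimodular constant \<open>e1\<close> that supplies the
  phase. Cauchy's estimate on unit discs passes the closeness to derivatives.\<close>

lemma near_sine_of_transfer:
  fixes R \<tau> \<epsilon> \<delta> :: real
  assumes kn: "k < n" and \<tau>: "\<tau> > 0"
    and diag: "\<And>z. cmod z \<le> R + 1 \<Longrightarrow> cmod (transfer_diag k n (z / of_real \<tau>) - exp (\<i> * of_real pi * z)) \<le> 3 * \<epsilon>"
    and off: "\<And>z. cmod z \<le> R + 1 \<Longrightarrow> cmod (transfer_off k n (z / of_real \<tau>)) \<le> 2 * \<epsilon>"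
    and \<delta>: "0 < \<delta>" "\<delta> \<le> 1/4" "5 * \<epsilon> < sin (pi * \<delta>)" "5 * \<epsilon> < 1"
  obtains D D' \<gamma> where "near_sine D D' \<gamma> R (5 * \<epsilon>) \<delta>"
    and "\<And>y. eigenvalue (jacobi_trunc a b k n) (\<xi> + y / \<tau>) \<longleftrightarrow> D y = 0"
proof -
  define \<rho> where "\<rho> = cmod (\<psi> (n + 1)) * cmod (\<psi> k)"
  have \<rho>: "\<rho> > 0" using psi_nonzero by (simp add: \<rho>_def)
  define e1 where "e1 = \<psi> (n + 1) * cnj (\<psi> k) / of_real \<rho>"
  define e2 where "e2 = \<psi> (n + 1) * \<psi> k / of_real \<rho>"
  have e12: "cmod e1 = 1" "cmod e2 = 1"
    using psi_nonzero by (simp_all add: e1_def e2_def \<rho>_def norm_mult norm_divide)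
  define \<gamma> where "\<gamma> = - Arg e1 / pi"
  have e1_exp: "e1 = exp (\<i> * of_real (- pi * \<gamma>))"
  proof -
    have "e1 \<noteq> 0" using e12 by auto
    then have "e1 = exp (\<i> * of_real (Arg e1))"
      using cis_Arg[of e1] e12 by (simp add: cis_conv_exp sgn_eq)
    then show ?thesis by (simp add: \<gamma>_def)
  qed
  define G where "G = (\<lambda>z. e1 * transfer_diag k n (z / of_real \<tau>) - e2 * transfer_off k n (z / of_real \<tau>))"
  define S where "S = (\<lambda>z. e1 * exp (\<i> * of_real pi * z))"
  have holG: "G holomorphic_on A" for A unfolding G_def by (intro holomorphic_intros holomorphic_transfer)
  have holS: "S holomorphic_on A" for A unfolding S_def by (intro holomorphic_intros)
  have close: "cmod (G z - S z) \<le> 5 * \<epsilon>" if "cmod z \<le> R + 1" for z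
  proof -
    have "G z - S z = e1 * (transfer_diag k n (z / of_real \<tau>) - exp (\<i> * of_real pi * z)) - e2 * transfer_off k n (z / of_real \<tau>)"
      by (simp add: G_def S_def algebra_simps)
    also have "cmod \<dots> \<le> 3 * \<epsilon> + 2 * \<epsilon>"
      by (intro norm_triangle_le_diff add_mono) (use diag[OF that] off[OF that] in \<open>simp_all add: norm_mult e12\<close>)
    finally show ?thesis by simp
  qed
  have S_real: "S (of_real y) = exp (\<i> * of_real (pi * (y - \<gamma>)))" for y
    unfolding S_def e1_exp by (simp add: algebra_simps flip: exp_add)
  have dS: "(S has_field_derivative \<i> * of_real pi * S z) (at z)" for z
    unfolding S_def by (auto intro!: derivative_eq_intros)
  have dG: "(G has_field_derivative deriv G z) (at z)" for z
    by (rule holomorphic_derivI[OF holG open_UNIV UNIV_I])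
  have close': "cmod (deriv G z - \<i> * of_real pi * S z) \<le> 5 * \<epsilon>" if z: "cmod z \<le> R" for z
  proof -
    have "cmod ((deriv ^^ 1) (\<lambda>z. G z - S z) z) \<le> fact 1 * (5 * \<epsilon>) / 1 ^ 1"
    proof (rule Cauchy_inequality)
      show "(\<lambda>z. G z - S z) holomorphic_on ball z 1" by (intro holomorphic_intros holG holS)
      show "continuous_on (cball z 1) (\<lambda>z. G z - S z)"
        by (intro holomorphic_on_imp_continuous_on holomorphic_intros holG holS)
      show "cmod (G x - S x) \<le> 5 * \<epsilon>" if "cmod (z - x) = 1" for x
        using norm_triangle_ineq3[of x z] that z by (intro close) (simp add: norm_minus_commute)
    qed simp
    moreover have "deriv (\<lambda>z. G z - S z) z = deriv G z - \<i> * of_real pi * S z"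
      by (rule DERIV_imp_deriv[OF DERIV_diff[OF dG dS]])
    ultimately show ?thesis by simp
  qed
  define D where "D = (\<lambda>y. Im (G (of_real y)))"
  define D' where "D' = (\<lambda>y. Im (deriv G (of_real y)))"
  have "near_sine D D' \<gamma> R (5 * \<epsilon>) \<delta>"
  proof
    fix y :: real assume y: "\<bar>y\<bar> \<le> R"
    have "((\<lambda>y. G (of_real y)) has_vector_derivative deriv G (of_real y)) (at y)"
      by (rule has_vector_derivative_real_field[OF dG])
    from bounded_linear.has_vector_derivative[OF bounded_linear_Im this]
    show "(D has_real_derivative D' y) (at y)"
      by (simp add: D_def D'_def has_real_derivative_iff_has_vector_derivative)
    have "sin (pi * (y - \<gamma>)) = Im (S (of_real y))" unfolding S_real by (simp add: Im_exp)
    then have "\<bar>D y - sin (pi * (y - \<gamma>))\<bar> = \<bar>Im (G (of_real y) - S (of_real y))\<bar>" by (simp add: D_def)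
    also have "\<dots> \<le> 5 * \<epsilon>" using close[of "of_real y"] y by (intro order_trans[OF abs_Im_le_cmod]) simp
    finally show "\<bar>D y - sin (pi * (y - \<gamma>))\<bar> \<le> 5 * \<epsilon>" .
    have "pi * cos (pi * (y - \<gamma>)) = Im (\<i> * of_real pi * S (of_real y))" unfolding S_real by (simp add: Re_exp)
    then have "\<bar>D' y - pi * cos (pi * (y - \<gamma>))\<bar> = \<bar>Im (deriv G (of_real y) - \<i> * of_real pi * S (of_real y))\<bar>"
      by (simp add: D'_def)
    also have "\<dots> \<le> 5 * \<epsilon>" using close'[of "of_real y"] y by (intro order_trans[OF abs_Im_le_cmod]) simp
    finally show "\<bar>D' y - pi * cos (pi * (y - \<gamma>))\<bar> \<le> 5 * \<epsilon>" .
  qed (use \<delta> in auto)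
  moreover have "eigenvalue (jacobi_trunc a b k n) (\<xi> + y / \<tau>) \<longleftrightarrow> D y = 0" for y
  proof -
    have "D y = Im (\<psi> (n + 1) * (cnj (\<psi> k) * transfer_diag k n (of_real (y / \<tau>)) - \<psi> k * transfer_off k n (of_real (y / \<tau>))) / of_real \<rho>)"
      unfolding D_def G_def e1_def e2_def by (simp add: diff_divide_distrib right_diff_distrib mult.assoc)
    then show ?thesis unfolding eigenvalue_iff_transfer[OF kn] using \<rho> by (simp only: Im_divide_of_real) simp
  qed
  ultimately show ?thesis by (rule that)
qed

text \<open>The condition on the ratio makes \<open>cc (n l)\<close> and \<open>cc (k l)\<close> at
  most a fixed multiple \<open>Q\<close> of the scale \<open>\<tau> l\<close> of the interval, so
  that the asymptotics at both endpoints hold on a common disc.\<close>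

lemma eventually_labelled_eig_spacing:
  fixes k n :: "nat \<Rightarrow> int" and j :: int
  assumes lp: "limit_point_both a b"
    and nl: "((\<lambda>y. m_plus a b (Complex \<xi> y)) \<longlongrightarrow> - \<psi> 1 / (of_real (a 0) * \<psi> 0)) (at_right 0)"
    and kn: "\<And>l. k l < n l" and k_bdd: "bdd_below (range k)"
    and n_top: "filterlim n at_top sequentially"
    and ratio: "limsup (\<lambda>l. ereal (cc (k l) / cc (n l))) < 1"
    and \<delta>: "0 < \<delta>" "\<delta> \<le> 1/4"
  shows "\<forall>\<^sub>F l in sequentially.
    (\<exists>x. is_labelled_eig a b \<xi> (k l) (n l) j x) \<and> (\<exists>x. is_labelled_eig a b \<xi> (k l) (n l) (j + 1) x) \<and>
    \<bar>scale_c a \<psi> (k l) (n l) *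
      (labelled_eig a b \<xi> (k l) (n l) (j + 1) - labelled_eig a b \<xi> (k l) (n l) j) - 1\<bar> \<le> 2 * \<delta>"
proof -
  obtain k0 where k0: "\<And>l. k0 \<le> k l" using k_bdd unfolding bdd_below_def by auto
  obtain \<rho>' where \<rho>': "limsup (\<lambda>l. ereal (cc (k l) / cc (n l))) < ereal \<rho>'" "ereal \<rho>' < 1"
    using ereal_dense2[OF ratio] by blast
  define \<rho> where "\<rho> = max \<rho>' 0"
  have \<rho>: "0 \<le> \<rho>" "\<rho> < 1" using \<rho>'(2) by (auto simp: \<rho>_def)
  define Q where "Q = 1 / (1 - \<rho>)"
  define \<tau> where "\<tau> = (\<lambda>l. cc (n l) - cc (k l))"
  have \<tau>_scale: "scale_c a \<psi> (k l) (n l) = \<tau> l" for l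
    using kn[of l] by (simp add: \<tau>_def scale_c_diff)
  have cn_top: "filterlim (\<lambda>l. cc (n l)) at_top sequentially"
    by (rule filterlim_compose[OF cc_at_top[OF lp] n_top])
  have ev_ratio: "\<forall>\<^sub>F l in sequentially. cc (k l) / cc (n l) < \<rho>'"
    using Limsup_lessD[OF \<rho>'(1)] by simp
  have ev: "\<forall>\<^sub>F l in sequentially. (1 - \<rho>) * cc (n l) \<le> \<tau> l \<and> \<tau> l > 0 \<and>
      \<bar>cc (n l)\<bar> \<le> Q * \<tau> l \<and> \<bar>cc (k l)\<bar> \<le> Q * \<tau> l"
    using ev_ratio eventually_compose_filterlim[OF eventually_gt_at_top[of "\<bar>cc k0\<bar>"] cn_top]
  proof eventually_elim
    case (elim l)
    have c: "cc (n l) > 0" using elim by linarith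
    have "cc (k l) / cc (n l) \<le> \<rho>" using elim by (simp add: \<rho>_def)
    then have "cc (k l) \<le> \<rho> * cc (n l)" using c by (simp add: divide_le_eq)
    then have 1: "(1 - \<rho>) * cc (n l) \<le> \<tau> l" by (simp add: \<tau>_def algebra_simps)
    have 2: "(1 - \<rho>) * cc (n l) > 0" using c \<rho> by simp
    have 3: "cc (n l) \<le> Q * \<tau> l" using 1 \<rho> by (simp add: Q_def field_simps)
    have "cc (k l) \<le> cc (n l)" using kn[of l] by (intro cc_mono) simp
    moreover have "cc k0 \<le> cc (k l)" by (rule cc_mono[OF k0])
    ultimately have "\<bar>cc (k l)\<bar> \<le> cc (n l)" using elim by linarith
    then show ?case using 1 2 3 c by linarith
  qed
  have \<tau>_top: "filterlim \<tau> at_top sequentially"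
  proof (rule filterlim_at_top_mono)
    show "filterlim (\<lambda>l. (1 - \<rho>) * cc (n l)) at_top sequentially"
      by (rule filterlim_tendsto_pos_mult_at_top[OF tendsto_const _ cn_top]) (use \<rho> in simp)
    show "\<forall>\<^sub>F l in sequentially. (1 - \<rho>) * cc (n l) \<le> \<tau> l"
      using ev by eventually_elim simp
  qed
  define R where "R = 2 * \<bar>real_of_int j\<bar> + 4"
  define M where "M = 1 + exp (pi * (R + 1) * Q)"
  define \<epsilon> where "\<epsilon> = min (sin (pi * \<delta>)) 1 / 10"
  define \<epsilon>1 where "\<epsilon>1 = min 1 (\<epsilon> / M)"
  have sin_pos: "sin (pi * \<delta>) > 0" using \<delta> by (intro sin_gt_zero) auto
  then have "\<epsilon> > 0" "\<epsilon> \<le> sin (pi * \<delta>) / 10" "\<epsilon> \<le> 1 / 10" by (simp_all add: \<epsilon>_def)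
  with sin_pos have \<epsilon>: "\<epsilon> > 0" "5 * \<epsilon> < sin (pi * \<delta>)" "5 * \<epsilon> < 1" by linarith+
  have M: "M > 0" unfolding M_def by (simp add: add_pos_pos)
  have \<epsilon>1: "\<epsilon>1 > 0" "\<epsilon>1 \<le> 1" using \<epsilon> M by (simp_all add: \<epsilon>1_def)
  have M\<epsilon>1: "M * \<epsilon>1 \<le> \<epsilon>"
  proof -
    have "M * \<epsilon>1 \<le> M * (\<epsilon> / M)" using M by (intro mult_left_mono) (auto simp: \<epsilon>1_def)
    then show ?thesis using M by simp
  qed
  have R: "R + 1 > 0" by (simp add: R_def add_nonneg_pos)
  have "\<forall>\<^sub>F l in sequentially. \<forall>i\<ge>k0. \<bar>cc i\<bar> \<le> Q * \<tau> l \<longrightarrow> (\<forall>z. cmod z \<le> R + 1 \<longrightarrow>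
    cmod (cA i (z / of_real (\<tau> l)) - exp (\<i> * of_real pi * z * of_real (cc i / \<tau> l))) < \<epsilon>1 \<and>
    cmod (cB i (z / of_real (\<tau> l))) < \<epsilon>1)"
    by (rule eventually_compose_filterlim[OF transfer_asymptotics[OF lp nl \<epsilon>1(1) R] \<tau>_top])
  then show ?thesis using ev
  proof eventually_elim
    case (elim l)
    have \<tau>l: "\<tau> l > 0" using elim by blast
    have cd: "\<bar>cc (n l) / \<tau> l\<bar> \<le> Q" "\<bar>cc (k l) / \<tau> l\<bar> \<le> Q" "cc (n l) / \<tau> l - cc (k l) / \<tau> l = 1"
      using elim \<tau>l by (simp_all add: abs_divide divide_le_eq flip: diff_divide_distrib) (simp add: \<tau>_def)
    have An: "cmod (cA (n l) (z / of_real (\<tau> l)) - exp (\<i> * of_real pi * z * of_real (cc (n l) / \<tau> l))) < \<epsilon>1 \<and>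
        cmod (cB (n l) (z / of_real (\<tau> l))) < \<epsilon>1" if "cmod z \<le> R + 1" for z
      using elim k0[of l] kn[of l] that by auto
    have Ak: "cmod (cA (k l) (z / of_real (\<tau> l)) - exp (\<i> * of_real pi * z * of_real (cc (k l) / \<tau> l))) < \<epsilon>1 \<and>
        cmod (cB (k l) (z / of_real (\<tau> l))) < \<epsilon>1" if "cmod z \<le> R + 1" for z
      using elim k0[of l] that by auto
    have diag: "cmod (transfer_diag (k l) (n l) (z / of_real (\<tau> l)) - exp (\<i> * of_real pi * z)) \<le> 3 * \<epsilon>"
      and off: "cmod (transfer_off (k l) (n l) (z / of_real (\<tau> l))) \<le> 2 * \<epsilon>" if z: "cmod z \<le> R + 1" for z
      using transfer_estimate[OF An Ak cd \<epsilon>1(2) z eq_refl[OF M_def[symmetric]]] M\<epsilon>1 by linarith+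
    obtain D D' \<gamma> where ns: "near_sine D D' \<gamma> R (5 * \<epsilon>) \<delta>"
      and eig: "\<And>y. eigenvalue (jacobi_trunc a b (k l) (n l)) (\<xi> + y / \<tau> l) \<longleftrightarrow> D y = 0"
      using near_sine_of_transfer[OF kn \<tau>l diag off \<delta> \<epsilon>(2,3)] by blast
    show ?case
      unfolding \<tau>_scale
      by (rule near_sine.labelled_eig_spacing[OF ns finite_jacobi_trunc_eigenvalues \<tau>l])
        (use eig in \<open>auto simp: R_def\<close>)
  qed
qed

end

theorem theorem1p2:
  fixes a b :: "int \<Rightarrow> real" and \<xi> :: real and \<eta> :: complex
    and \<psi> :: "int \<Rightarrow> complex" and k n :: "nat \<Rightarrow> int"
  assumes a_pos: "\<And>i. a i > 0"
    and limit_point: "limit_point_both a b"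
    and normal_limit: "((\<lambda>y. m_plus a b (Complex \<xi> y)) \<longlongrightarrow> \<eta>) (at_right 0)"
    and eta_upper: "Im \<eta> > 0"
    and psi_solution: "\<And>i. jacobi a b \<psi> i = of_real \<xi> * \<psi> i"
    and psi_nontrivial: "\<exists>i. \<psi> i \<noteq> 0"
    and psi_eta: "- \<psi> 1 / (of_real (a 0) * \<psi> 0) = \<eta>"
    and k_less_n: "\<And>l. k l < n l"
    and k_bounded: "bdd_below (range k)"
    and n_tendsto: "filterlim n at_top sequentially"
    and ratio: "limsup (\<lambda>l. ereal (scale_c a \<psi> 0 (k l) / scale_c a \<psi> 0 (n l))) < 1"
  shows "\<forall>j::int.
    (\<forall>\<^sub>F l in sequentially.
       (\<exists>x. is_labelled_eig a b \<xi> (k l) (n l) j x) \<and>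
       (\<exists>x. is_labelled_eig a b \<xi> (k l) (n l) (j + 1) x)) \<and>
    (\<lambda>l. scale_c a \<psi> (k l) (n l) *
         (labelled_eig a b \<xi> (k l) (n l) (j + 1) - labelled_eig a b \<xi> (k l) (n l) j))
      \<longlonglongrightarrow> 1"
proof
  fix j :: int
  have \<psi>0: "\<psi> 0 \<noteq> 0" using psi_eta eta_upper by auto
  have "- \<psi> 1 = \<eta> * of_real (a 0) * \<psi> 0"
    using psi_eta \<psi>0 a_pos[of 0] by (auto simp: field_simps)
  then have "\<psi> 1 = - \<eta> * of_real (a 0) * \<psi> 0"
    by (metis minus_minus mult_minus_left)
  then have "wronskian a (\<lambda>m. cnj (\<psi> m)) \<psi> 0 = (\<eta> - cnj \<eta>) * (of_real (a 0))\<^sup>2 * (\<psi> 0 * cnj (\<psi> 0))"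
    by (simp add: wronskian_def algebra_simps power2_eq_square)
  also have "\<dots> = \<i> * of_real (2 * Im \<eta> * (a 0)\<^sup>2 * (cmod (\<psi> 0))\<^sup>2)"
    by (simp add: complex_diff_cnj) (metis complex_norm_square of_real_power)
  finally have W: "Im (wronskian a (\<lambda>m. cnj (\<psi> m)) \<psi> 0) = 2 * Im \<eta> * (a 0)\<^sup>2 * (cmod (\<psi> 0))\<^sup>2"
    by (simp only: Im_i_times Re_complex_of_real)
  have "Im (wronskian a (\<lambda>m. cnj (\<psi> m)) \<psi> 0) > 0"
    unfolding W using eta_upper a_pos[of 0] \<psi>0 by simp
  then interpret jacobi_solution a b \<xi> \<psi>
    using a_pos psi_solution by unfold_locales
  note spacing = eventually_labelled_eig_spacing[OF limit_point normal_limit[folded psi_eta] k_less_n k_bounded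
      n_tendsto ratio[folded cc_def], of _ j]
  show "(\<forall>\<^sub>F l in sequentially.
       (\<exists>x. is_labelled_eig a b \<xi> (k l) (n l) j x) \<and>
       (\<exists>x. is_labelled_eig a b \<xi> (k l) (n l) (j + 1) x)) \<and>
    (\<lambda>l. scale_c a \<psi> (k l) (n l) *
         (labelled_eig a b \<xi> (k l) (n l) (j + 1) - labelled_eig a b \<xi> (k l) (n l) j))
      \<longlonglongrightarrow> 1"
  proof
    show "\<forall>\<^sub>F l in sequentially.
       (\<exists>x. is_labelled_eig a b \<xi> (k l) (n l) j x) \<and>
       (\<exists>x. is_labelled_eig a b \<xi> (k l) (n l) (j + 1) x)"
      using spacing[of "1/4"] by (simp add: eventually_conj_iff)
    show "(\<lambda>l. scale_c a \<psi> (k l) (n l) *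
         (labelled_eig a b \<xi> (k l) (n l) (j + 1) - labelled_eig a b \<xi> (k l) (n l) j))
      \<longlonglongrightarrow> 1"
      unfolding tendsto_iff
    proof (intro allI impI)
      fix e :: real assume e: "e > 0"
      define \<delta> where "\<delta> = min (1/4) (e/4)"
      have \<delta>: "0 < \<delta>" "\<delta> \<le> 1/4" "2 * \<delta> < e" using e by (auto simp: \<delta>_def)
      show "\<forall>\<^sub>F l in sequentially. dist (scale_c a \<psi> (k l) (n l) *
         (labelled_eig a b \<xi> (k l) (n l) (j + 1) - labelled_eig a b \<xi> (k l) (n l) j)) 1 < e"
        using spacing[OF \<delta>(1,2)]
      proof eventually_elim
        case (elim l)
        then show ?case using \<delta>(3) by (simp add: dist_real_def)
      qed
    qed
  qed
qed

end
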